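(* Let $n\ge1$, let $\lambda$ be a partition with at most $n$ parts, let $i\in\{1,\dots,n-1\}$, and let $T_0,\dots,T_{2k}$ be a double $i$-string in $\mathrm{SVT}_n(\lambda)$. Write $C_j:=C_{T_j}$. Then $$\dim C_{2j+1}=\dim C_{2j}+1=\dim C_{2j+2}+1\qquad(0\le j\le k-1);$$ equivalently, $\dim C_{T_j}=\mathrm{ex}(T_0)+(j\bmod 2)$ for all $j$. In particular a double $i$-string has odd length, and its cells alternate between two consecutive dimensions.
   Context: Fix $n\ge1$, a partition $\lambda=(\lambda_1\ge\dots\ge\lambda_n\ge0)$, $[n]=\{1,\dots,n\}$. The Young diagram of $\lambda$ (English convention) has cells $(r,c)$, $1\le r\le n$, $1\le c\le\lambda_r$. **Set-valued tableaux.** A set-valued tableau of shape $\lambda$ is a filling $T$ of the cells by non-empty subsets of $[n]$ such that $\max T(r,c)\le\min T(r,c+1)$ and $\max T(r,c)<\min T(r+1,c)$ whenever both cells exist. $\mathrm{SVT}_n(\lambda)$ is the set of these; $\mathrm{ex}(T)=\sum_{(r,c)}(|T(r,c)|-1)$. **Operators (Yu).** Fix $i\in[n-1]$. Read the cells of $T$ column by column from left to right, each column from bottom to top. Each cell contributes: ")" if it contains $i$ but not $i+1$; "(" if it contains $i+1$ but not $i$; the string ")-(" if it contains both; nothing otherwise. Match brackets in the usual way (a "(" with a later ")"), ignoring dashes. The classes are the equivalence classes of brackets generated by: two matched brackets are equivalent, and two brackets joined by a dash are equivalent. A class (read left to right) is of right form if it begins with an unmatched ")" and does not end with an unmatched "(";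 of left form if it ends with an unmatched "(" and does not begin with an unmatched ")"; of combined form if it begins with an unmatched ")" and ends with an unmatched "(". $f'_i(T)$: if a class of combined form occurs, delete $i$ from the cell contributing the initial ")" of the first such class; otherwise add $i+1$ to the cell contributing the final ")" of the last class of right form; $f'_i(T)=0$ if there is none. $e'_i(T)$ is defined symmetrically: if a class of combined form occurs, delete $i+1$ from the cell contributing the final "(" of the last such class; otherwise add $i$ to the cell contributing the initial "(" of the first class of left form; $e'_i(T)=0$ if there is none. These are well defined with values in $\mathrm{SVT}_n(\lambda)\sqcup\{0\}$. A double $i$-string is a maximal sequence $T_0,\dots,T_{2k}$ in $\mathrm{SVT}_n(\lambda)$ with $e'_i(T_0)=f'_i(T_{2k})=0$ and $f'_i(T_j)=T_{j+1}$ for $0\le j<2k$; $\mathrm{SVT}_n(\lambda)$ is the disjoint union of its double $i$-strings. **Gelfand–Zetlin patterns.** A Gelfand–Zetlin pattern with top row $\lambda$ is an array of integers $a_{ij}$ ($0\le i\le n-1$, $1\le j\le n-i$) with $a_{0,j}=\lambda_{n+1-j}$ and $a_{i-1,j}\le a_{ij}\le a_{i-1,j+1}$ for $i\ge1$. $GZ(\lambda)\subset\mathbb R^{n(n-1)/2}$ is the polytope of real points $(y_{ij})_{1\le i\le n-1,1\le j\le n-i}$ satisfying $y_{i-1,j}\le y_{ij}\le y_{i-1,j+1}$, with $y_{0,j}=\lambda_{n+1-j}$. **Enhancement attached to $T$.** For $0\le k\le n$ let $\nu^{(k)}(T)$ be the partition formed by the cells with $\min T(r,c)\le k$; put $a_{ij}=\nu^{(k)}_r(T)$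 with $k=n-i$, $r=k-j+1$; this is a Gelfand–Zetlin pattern. Let $U(T)$ be the set of positions $(n-k,k-r+1)$ such that $1\le k\le n-1$ and the letter $k+1$ is a non-minimal element of some cell in row $r$ of $T$. Encircle all positions outside $U(T)$, and draw edges by the following procedure: equal neighboring entries of row $0$ are declared connected; scan rows from top to bottom; from an encircled $(i,j)$, $i\ge1$: if $a_{ij}$ equals neither $a_{i-1,j}$ nor $a_{i-1,j+1}$, draw no edge upwards; if it equals exactly one of them, join $(i,j)$ to that one; if it equals both, join $(i,j)$ to both when $(i-1,j)$ and $(i-1,j+1)$ are already joined by a path of edges lying in rows $\le i-1$ (connections declared in row $0$ count), and to $(i-1,j+1)$ alone otherwise. Non-encircled entries receive no upward edges. The result is denoted $P=\widetilde\Phi(T)$. **Cells.** For each $(i,j)$, $i\ge1$, impose: (1) for an edge from $(i,j)$ to $(i-1,j)$ (resp. $(i-1,j+1)$), $y_{ij}=y_{i-1,j}$ (resp. $y_{ij}=y_{i-1,j+1}$); (2) if no edge goes up from $(i,j)$ and it is encircled, $y_{ij}=a_{ij}$; (3) if no edge goes up and it is not encircled, the strict inequalities: $a_{ij}-1<y_{ij}$ if $a_{ij}-a_{i-1,j}\ge2$ and $y_{i-1,j}<y_{ij}$ otherwise; $y_{ij}<y_{i-1,j+1}$ if $a_{i-1,j+1}=a_{ij}$ and $y_{ij}<a_{ij}$ otherwise. Let $\widehat{C_P}$ be the set so defined, $L$ its affine span, and $C_T:=C_P=\widehat{C_P}\cap(GZ(\lambda)\cap L)^\circ$ (relative interior in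 $L$). $\dim C_T$ is the dimension of its affine span. *)

theory Defs
  imports "HOL-Analysis.Analysis"
begin

section \<open>Set-valued tableaux\<close>

text \<open>
  A partition with at most \<open>n\<close> parts is a function of which only the values
  at \<open>1, \<dots>, n\<close> are relevant; rows, columns and letters are numbered from \<open>1\<close>.
\<close>

definition is_partition :: "nat \<Rightarrow> (nat \<Rightarrow> nat) \<Rightarrow> bool" where
  "is_partition n lam \<longleftrightarrow> (\<forall>r. 1 \<le> r \<and> r < n \<longrightarrow> lam (r + 1) \<le> lam r)"

type_synonym cell = "nat \<times> nat"
type_synonym filling = "cell \<Rightarrow> nat set"

definition cells :: "nat \<Rightarrow> (nat \<Rightarrow> nat) \<Rightarrow> cell set" where
  "cells n lam = {(r, c). 1 \<le> r \<and> r \<le> n \<and> 1 \<le> c \<and> c \<le> lam r}"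

text \<open>
  Fillings are normalised to be empty outside the diagram, so that equality of
  functions is equality of tableaux.
\<close>

definition SVT :: "nat \<Rightarrow> (nat \<Rightarrow> nat) \<Rightarrow> filling set" where
  "SVT n lam = {T.
     (\<forall>x. x \<notin> cells n lam \<longrightarrow> T x = {}) \<and>
     (\<forall>x \<in> cells n lam. T x \<noteq> {} \<and> T x \<subseteq> {1..n}) \<and>
     (\<forall>r c. (r, c) \<in> cells n lam \<and> (r, c + 1) \<in> cells n lam \<longrightarrow>
        Max (T (r, c)) \<le> Min (T (r, c + 1))) \<and>
     (\<forall>r c. (r, c) \<in> cells n lam \<and> (r + 1, c) \<in> cells n lam \<longrightarrow>
        Max (T (r, c)) < Min (T (r + 1, c)))}"

definition ex :: "nat \<Rightarrow> (nat \<Rightarrow> nat) \<Rightarrow> filling \<Rightarrow> nat" where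
  "ex n lam T = (\<Sum>x \<in> cells n lam. card (T x) - 1)"


section \<open>Yu's operators\<close>

text \<open>\<open>Close\<close> stands for ``)'' and \<open>Open\<close> for ``(''.\<close>

datatype bracket = Open | Close

type_synonym bracket_word = "(bracket \<times> cell) list"

definition reading_order :: "nat \<Rightarrow> (nat \<Rightarrow> nat) \<Rightarrow> cell list" where
  "reading_order n lam =
     concat (map (\<lambda>c. map (\<lambda>r. (r, c)) (filter (\<lambda>r. c \<le> lam r) (rev [1..<n + 1])))
       [1..<lam 1 + 1])"

definition cell_brackets :: "nat \<Rightarrow> filling \<Rightarrow> cell \<Rightarrow> bracket_word" where
  "cell_brackets i T x =
     (if i \<in> T x then [(Close, x)] else []) @ (if i + 1 \<in> T x then [(Open, x)] else [])"

definition bracket_word :: "nat \<Rightarrow> (nat \<Rightarrow> nat) \<Rightarrow> nat \<Rightarrow> filling \<Rightarrow> bracket_word" where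
  "bracket_word n lam i T = concat (map (cell_brackets i T) (reading_order n lam))"

text \<open>
  Brackets of a word are identified with their positions. Two brackets are
  matched iff the brackets strictly between them form a balanced word.
\<close>

inductive balanced :: "bracket list \<Rightarrow> bool" where
  "balanced []"
| "balanced u \<Longrightarrow> balanced v \<Longrightarrow> balanced (Open # u @ Close # v)"

definition matched :: "bracket_word \<Rightarrow> nat \<Rightarrow> nat \<Rightarrow> bool" where
  "matched w p q \<longleftrightarrow>
     p < q \<and> q < length w \<and> fst (w ! p) = Open \<and> fst (w ! q) = Close \<and>
     balanced (map (\<lambda>s. fst (w ! s)) [p + 1..<q])"

definition unmatched :: "bracket_word \<Rightarrow> nat \<Rightarrow> bool" where
  "unmatched w p \<longleftrightarrow> (\<nexists>q. matched w p q \<or> matched w q p)"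

text \<open>The two brackets of one cell are adjacent in the word and joined by a dash.\<close>

definition dashed :: "bracket_word \<Rightarrow> nat \<Rightarrow> nat \<Rightarrow> bool" where
  "dashed w p q \<longleftrightarrow> p < length w \<and> q < length w \<and>
     fst (w ! p) = Close \<and> fst (w ! q) = Open \<and> snd (w ! p) = snd (w ! q)"

definition classes :: "bracket_word \<Rightarrow> nat set set" where
  "classes w = {{q. equivclp (\<lambda>p q. matched w p q \<or> dashed w p q) p q} | p. p < length w}"

definition begins_unmatched :: "bracket_word \<Rightarrow> nat set \<Rightarrow> bool" where
  "begins_unmatched w K \<longleftrightarrow> fst (w ! Min K) = Close \<and> unmatched w (Min K)"

definition ends_unmatched :: "bracket_word \<Rightarrow> nat set \<Rightarrow> bool" where
  "ends_unmatched w K \<longleftrightarrow> fst (w ! Max K) = Open \<and> unmatched w (Max K)"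

definition right_classes :: "bracket_word \<Rightarrow> nat set set" where
  "right_classes w = {K \<in> classes w. begins_unmatched w K \<and> \<not> ends_unmatched w K}"

definition left_classes :: "bracket_word \<Rightarrow> nat set set" where
  "left_classes w = {K \<in> classes w. ends_unmatched w K \<and> \<not> begins_unmatched w K}"

definition combined_classes :: "bracket_word \<Rightarrow> nat set set" where
  "combined_classes w = {K \<in> classes w. begins_unmatched w K \<and> ends_unmatched w K}"

text \<open>
  Classes of one of the three forms occupy pairwise disjoint intervals of the
  word, so that ``first'' and ``last'' are unambiguous for them.
\<close>

definition first_class :: "nat set set \<Rightarrow> nat set" where
  "first_class Ks = (ARG_MIN Min K. K \<in> Ks)"

definition last_class :: "nat set set \<Rightarrow> nat set" where
  "last_class Ks = (ARG_MAX Max K. K \<in> Ks)"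

definition initial_cell :: "bracket_word \<Rightarrow> bracket \<Rightarrow> nat set \<Rightarrow> cell" where
  "initial_cell w b K = snd (w ! Min {p \<in> K. fst (w ! p) = b})"

definition final_cell :: "bracket_word \<Rightarrow> bracket \<Rightarrow> nat set \<Rightarrow> cell" where
  "final_cell w b K = snd (w ! Max {p \<in> K. fst (w ! p) = b})"

definition f_op :: "nat \<Rightarrow> (nat \<Rightarrow> nat) \<Rightarrow> nat \<Rightarrow> filling \<Rightarrow> filling option" where
  "f_op n lam i T =
     (let w = bracket_word n lam i T in
      if combined_classes w \<noteq> {} then
        let x = initial_cell w Close (first_class (combined_classes w))
        in Some (T(x := T x - {i}))
      else if right_classes w \<noteq> {} then
        let x = final_cell w Close (last_class (right_classes w))
        in Some (T(x := insert (i + 1) (T x)))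
      else None)"

definition e_op :: "nat \<Rightarrow> (nat \<Rightarrow> nat) \<Rightarrow> nat \<Rightarrow> filling \<Rightarrow> filling option" where
  "e_op n lam i T =
     (let w = bracket_word n lam i T in
      if combined_classes w \<noteq> {} then
        let x = final_cell w Open (last_class (combined_classes w))
        in Some (T(x := T x - {i + 1}))
      else if left_classes w \<noteq> {} then
        let x = initial_cell w Open (first_class (left_classes w))
        in Some (T(x := insert i (T x)))
      else None)"

text \<open>
  \<open>double_string n lam i T m\<close>: the sequence \<open>T 0, \<dots>, T m\<close> is a double \<open>i\<close>-string.
  The vanishing of \<open>e_op\<close> and \<open>f_op\<close> at the two ends is its maximality. That \<open>m\<close>
  is even is not required here.
\<close>

definition double_string ::
  "nat \<Rightarrow> (nat \<Rightarrow> nat) \<Rightarrow> nat \<Rightarrow> (nat \<Rightarrow> filling) \<Rightarrow> nat \<Rightarrow> bool" where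
  "double_string n lam i T m \<longleftrightarrow>
     (\<forall>j \<le> m. T j \<in> SVT n lam) \<and>
     e_op n lam i (T 0) = None \<and> f_op n lam i (T m) = None \<and>
     (\<forall>j < m. f_op n lam i (T j) = Some (T (j + 1)))"


section \<open>The enhanced Gelfand--Zetlin pattern of a tableau\<close>

text \<open>Positions \<open>(i, j)\<close> including row \<open>0\<close>; the coordinates \<open>y\<^sub>i\<^sub>j\<close> are those with \<open>i \<ge> 1\<close>.\<close>

definition positions :: "nat \<Rightarrow> (nat \<times> nat) set" where
  "positions n = {(i, j). i \<le> n - 1 \<and> 1 \<le> j \<and> j \<le> n - i}"

definition coord_positions :: "nat \<Rightarrow> (nat \<times> nat) set" where
  "coord_positions n = {(i, j). (i, j) \<in> positions n \<and> 1 \<le> i}"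

definition nu :: "nat \<Rightarrow> (nat \<Rightarrow> nat) \<Rightarrow> filling \<Rightarrow> nat \<Rightarrow> nat \<Rightarrow> nat" where
  "nu n lam T k r = card {c. (r, c) \<in> cells n lam \<and> Min (T (r, c)) \<le> k}"

text \<open>With \<open>k = n - i\<close> the row is \<open>r = k - j + 1\<close>, written so as to avoid truncation.\<close>

definition pattern :: "nat \<Rightarrow> (nat \<Rightarrow> nat) \<Rightarrow> filling \<Rightarrow> nat \<Rightarrow> nat \<Rightarrow> int" where
  "pattern n lam T i j = int (nu n lam T (n - i) (n - i + 1 - j))"

definition U_set :: "nat \<Rightarrow> (nat \<Rightarrow> nat) \<Rightarrow> filling \<Rightarrow> (nat \<times> nat) set" where
  "U_set n lam T = {(n - k, k + 1 - r) | k r.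
     1 \<le> k \<and> k \<le> n - 1 \<and>
     (\<exists>c. (r, c) \<in> cells n lam \<and> k + 1 \<in> T (r, c) \<and> k + 1 \<noteq> Min (T (r, c)))}"

definition encircled :: "nat \<Rightarrow> (nat \<Rightarrow> nat) \<Rightarrow> filling \<Rightarrow> (nat \<times> nat) set" where
  "encircled n lam T = positions n - U_set n lam T"

text \<open>
  Endpoints of the upward edges from \<open>(i, j)\<close>, \<open>i \<ge> 1\<close>, for a pattern \<open>a\<close> with
  encircled positions \<open>Enc\<close>; \<open>E\<close> is the set of edges in the rows \<open>\<le> i - 1\<close>.
\<close>

definition up_targets ::
  "(nat \<Rightarrow> nat \<Rightarrow> int) \<Rightarrow> (nat \<times> nat) set \<Rightarrow> ((nat \<times> nat) \<times> (nat \<times> nat)) set \<Rightarrow>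
     nat \<Rightarrow> nat \<Rightarrow> (nat \<times> nat) set" where
  "up_targets a Enc E i j =
     (if (i, j) \<notin> Enc then {}
      else if a i j = a (i - 1) j \<and> a i j = a (i - 1) (j + 1) then
        (if ((i - 1, j), (i - 1, j + 1)) \<in> (E \<union> E\<inverse>)\<^sup>*
         then {(i - 1, j), (i - 1, j + 1)} else {(i - 1, j + 1)})
      else if a i j = a (i - 1) j then {(i - 1, j)}
      else if a i j = a (i - 1) (j + 1) then {(i - 1, j + 1)}
      else {})"

primrec edges ::
  "nat \<Rightarrow> (nat \<Rightarrow> nat \<Rightarrow> int) \<Rightarrow> (nat \<times> nat) set \<Rightarrow> nat \<Rightarrow>
     ((nat \<times> nat) \<times> (nat \<times> nat)) set" where
  "edges n a Enc 0 = {((0, j), (0, j + 1)) | j. 1 \<le> j \<and> j < n \<and> a 0 j = a 0 (j + 1)}"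
| "edges n a Enc (Suc i) = edges n a Enc i \<union>
     {((Suc i, j), p) | j p. (Suc i, j) \<in> positions n \<and>
        p \<in> up_targets a Enc (edges n a Enc i) (Suc i) j}"

definition up_edges ::
  "nat \<Rightarrow> (nat \<Rightarrow> nat) \<Rightarrow> filling \<Rightarrow> nat \<Rightarrow> nat \<Rightarrow> (nat \<times> nat) set" where
  "up_edges n lam T i j =
     (let a = pattern n lam T; Enc = encircled n lam T
      in up_targets a Enc (edges n a Enc (i - 1)) i j)"


section \<open>The Gelfand--Zetlin polytope and its cells\<close>

text \<open>
  The space \<open>\<real>\<close> to the power \<open>n (n - 1) / 2\<close> is \<open>real ^ 'm\<close>, where \<open>idx\<close> labels the coordinates
  by the positions \<open>(i, j)\<close>, \<open>i \<ge> 1\<close>; it is always assumed to be a bijection from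
  \<open>coord_positions n\<close> onto \<open>UNIV :: 'm set\<close>. \<open>gz_entry\<close> adds the fixed row \<open>0\<close>.
\<close>

definition gz_entry ::
  "nat \<Rightarrow> (nat \<Rightarrow> nat) \<Rightarrow> (nat \<times> nat \<Rightarrow> 'm) \<Rightarrow> real ^ 'm \<Rightarrow> nat \<Rightarrow> nat \<Rightarrow> real" where
  "gz_entry n lam idx y i j = (if i = 0 then real (lam (n + 1 - j)) else y $ idx (i, j))"

definition GZ ::
  "nat \<Rightarrow> (nat \<Rightarrow> nat) \<Rightarrow> (nat \<times> nat \<Rightarrow> 'm) \<Rightarrow> (real ^ 'm) set" where
  "GZ n lam idx = {y. \<forall>(i, j) \<in> coord_positions n.
     gz_entry n lam idx y (i - 1) j \<le> gz_entry n lam idx y i j \<and>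
     gz_entry n lam idx y i j \<le> gz_entry n lam idx y (i - 1) (j + 1)}"

definition cell_hat ::
  "nat \<Rightarrow> (nat \<Rightarrow> nat) \<Rightarrow> (nat \<times> nat \<Rightarrow> 'm) \<Rightarrow> filling \<Rightarrow> (real ^ 'm) set" where
  "cell_hat n lam idx T = {y. \<forall>(i, j) \<in> coord_positions n.
     (let a = pattern n lam T; Y = gz_entry n lam idx y; up = up_edges n lam T i j
      in (\<forall>(k, l) \<in> up. Y i j = Y k l) \<and>
         (up = {} \<and> (i, j) \<in> encircled n lam T \<longrightarrow> Y i j = a i j) \<and>
         (up = {} \<and> (i, j) \<notin> encircled n lam T \<longrightarrow>
            (if a i j - a (i - 1) j \<ge> 2 then a i j - 1 < Y i j else Y (i - 1) j < Y i j) \<and>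
            (if a (i - 1) (j + 1) = a i j then Y i j < Y (i - 1) (j + 1) else Y i j < a i j)))}"

text \<open>The relative interior is taken in the affine span of \<open>cell_hat\<close>, not of \<open>GZ \<inter> L\<close>.\<close>

definition gz_cell ::
  "nat \<Rightarrow> (nat \<Rightarrow> nat) \<Rightarrow> (nat \<times> nat \<Rightarrow> 'm::finite) \<Rightarrow> filling \<Rightarrow> (real ^ 'm) set" where
  "gz_cell n lam idx T =
     (let L = affine hull (cell_hat n lam idx T)
      in cell_hat n lam idx T \<inter> (top_of_set L) interior_of (GZ n lam idx \<inter> L))"

end

theory Submission
  imports Defs
begin

text \<open>
  The dimension of a cell is the excess of its tableau (\<open>aff_dim_gz_cell\<close>), and along a double string the
  excess alternates between two consecutive values (\<open>double_string_excess\<close>). Together these two facts are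
  the theorem.

  For the first, consider the equations that the edges impose. Proceeding from the top row downwards,
  each encircled coordinate is either a constant or equal to a coordinate of the row above, and a
  position is joined to two entries only if these are already connected. So no component ever ties two
  earlier ones together, and the solutions are parametrised freely by the positions that are not
  encircled. Their number is the excess, because a letter can be non-minimal in at most one cell of a
  row. It remains to see that the inequalities do not lower the dimension, that is, that some point of
  the cell satisfies strictly every inequality that is not an equation. Such a point arises from the
  pattern by subtracting on every free component an amount below \<open>1\<close> that grows with the row in
  which the component starts. The one delicate inequality, between equal but unconnected
  neighbours of a row, is \<open>slack_less_across\<close>.

  For the second fact, follow the height of the bracket word, in which opening brackets count \<open>+1\<close> and
  closing brackets \<open>-1\<close>. The chain of a class beginning with an unmatched closing bracket runs along a
  record low of the height. Hence a combined class exists iff the minimum of the height is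
  attained only in the interior of cells, between their two brackets (\<open>combined_class_iff\<close>). If there is
  none, \<open>f_op\<close> inserts a bracket at the first cell boundary of minimal height; this moves that place into
  the interior of a cell and lifts the rest of the word, so that a combined class appears
  (\<open>insert_final_Open\<close>). If there is one, \<open>f_op\<close> removes the bracket that first reaches the minimum;
  the minimum rises by one and is then attained at a cell boundary, so that no combined class is
  left (\<open>delete_initial_Close\<close>). Insertions and deletions therefore alternate. A string starts without a
  combined class since \<open>e_op\<close> vanishes, and ends without one since \<open>f_op\<close> vanishes.
\<close>

section \<open>Heights of bracket words\<close>

definition height :: "bracket_word \<Rightarrow> nat \<Rightarrow> int" where
  "height w k = (\<Sum>s<k. if fst (w ! s) = Open then 1 else -1)"

lemma height_0 [simp]: "height w 0 = 0"
  by (simp add: height_def)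

lemma height_Suc: "height w (Suc k) = height w k + (if fst (w ! k) = Open then 1 else -1)"
  by (simp add: height_def)

lemma height_append_left: "k \<le> length u \<Longrightarrow> height (u @ v) k = height u k"
  by (simp add: height_def nth_append)

lemma height_append_right:
  "height (u @ v) (length u + k) = height u (length u) + height v k"
proof (induction k)
  case 0
  show ?case by (simp add: height_append_left)
next
  case (Suc k)
  then show ?case by (simp add: height_Suc)
qed

lemma balanced_heights:
  assumes "balanced xs"
  shows "(\<Sum>b\<leftarrow>xs. if b = Open then 1 else -1 :: int) = 0 \<and>
    (\<forall>k. 0 \<le> (\<Sum>b\<leftarrow>take k xs. if b = Open then 1 else -1 :: int))"
  using assms
proof induction
  case 1
  show ?case by simp
next
  case (2 u v)
  show ?case
  proof (intro conjI allI)
    show "(\<Sum>b\<leftarrow>Open # u @ Close # v. if b = Open then 1 else -1 :: int) = 0"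
      using 2 by simp
    fix k
    show "0 \<le> (\<Sum>b\<leftarrow>take k (Open # u @ Close # v). if b = Open then 1 else -1 :: int)"
    proof (cases k)
      case (Suc l)
      show ?thesis
      proof (cases "l \<le> length u")
        case True
        then have "0 \<le> (\<Sum>b\<leftarrow>take l u. if b = Open then 1 else -1 :: int)"
          using 2 by blast
        then show ?thesis using Suc True by simp
      next
        case False
        then obtain d where "l = length u + Suc d"
          by (metis add_Suc_right less_imp_Suc_add not_le)
        then show ?thesis using Suc 2 by simp
      qed
    qed simp
  qed
qed

lemma sum_list_segment:
  assumes "p \<le> q" and "s \<le> q - p"
  shows "(\<Sum>b\<leftarrow>take s (map (\<lambda>s. fst (w ! s)) [p..<q]). if b = Open then 1 else -1)
    = height w (p + s) - height w p"
  using assms(2)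
proof (induction s)
  case (Suc s)
  then have "take (Suc s) [p..<q] = take s [p..<q] @ [p + s]"
    by (simp add: take_Suc_conv_app_nth)
  then show ?case using Suc by (simp add: take_map height_Suc)
qed simp

text \<open>
  A segment is balanced iff the height returns to its initial value without going below it. In the
  converse direction, cutting at the first return to the initial height yields the decomposition
  required by the inductive definition of \<^const>\<open>balanced\<close>.
\<close>

lemma balanced_segment_iff:
  assumes "p \<le> q"
  shows "balanced (map (\<lambda>s. fst (w ! s)) [p..<q]) \<longleftrightarrow>
    height w q = height w p \<and> (\<forall>s. p \<le> s \<and> s \<le> q \<longrightarrow> height w p \<le> height w s)"
proof
  assume bal: "balanced (map (\<lambda>s. fst (w ! s)) [p..<q])"
  have "height w p \<le> height w s" if "p \<le> s" "s \<le> q" for s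
  proof -
    have "0 \<le> height w (p + (s - p)) - height w p"
      using balanced_heights[OF bal] sum_list_segment[of p q "s - p" w] that
      by (metis (no_types, lifting) assms diff_le_mono)
    then show ?thesis using that by simp
  qed
  moreover have "height w q = height w p"
  proof -
    have "height w (p + (q - p)) - height w p = 0"
      using balanced_heights[OF bal] sum_list_segment[of p q "q - p" w] assms by simp
    then show ?thesis using assms by simp
  qed
  ultimately show "height w q = height w p \<and> (\<forall>s. p \<le> s \<and> s \<le> q \<longrightarrow> height w p \<le> height w s)"
    by blast
next
  assume "height w q = height w p \<and> (\<forall>s. p \<le> s \<and> s \<le> q \<longrightarrow> height w p \<le> height w s)"
  then show "balanced (map (\<lambda>s. fst (w ! s)) [p..<q])"
    using assms
  proof (induction "q - p" arbitrary: p q rule: less_induct)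
    case less
    show ?case
    proof (cases "p = q")
      case True
      then show ?thesis by (simp add: balanced.intros)
    next
      case False
      then have "p < q" using less.prems by simp
      have "\<exists>r. p < r \<and> height w r = height w p"
        using \<open>p < q\<close> less.prems by blast
      define r where "r = (LEAST r. p < r \<and> height w r = height w p)"
      have r: "p < r" "height w r = height w p" "r \<le> q"
        using LeastI_ex[OF \<open>\<exists>r. _\<close>] Least_le[of "\<lambda>r. p < r \<and> height w r = height w p" q]
          less.prems \<open>p < q\<close> unfolding r_def by auto
      have before: "height w p < height w s" if "p < s" "s < r" for s
      proof -
        have "height w s \<noteq> height w p"
          using not_less_Least[of s "\<lambda>r. p < r \<and> height w r = height w p"] that
          unfolding r_def by blast
        then show ?thesis using less.prems that r by (metis le_less less_trans order_less_le)
      qed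
      have opn: "fst (w ! p) = Open"
      proof -
        have "height w p \<le> height w (Suc p)" using less.prems \<open>p < q\<close> by auto
        then show ?thesis by (simp add: height_Suc split: if_splits)
      qed
      have "Suc p \<noteq> r" using r opn by (auto simp: height_Suc)
      then obtain r' where r': "r = Suc r'" "p < r'" using r by (cases r) auto
      have cls: "fst (w ! r') = Close" and h': "height w r' = height w p + 1"
        using before[of r'] r r' by (auto simp: height_Suc split: if_splits) (metis bracket.exhaust)
      have "balanced (map (\<lambda>s. fst (w ! s)) [Suc p..<r'])"
      proof (intro less.hyps conjI allI impI)
        show "r' - Suc p < q - p" "Suc p \<le> r'" using r r' by auto
        show "height w r' = height w (Suc p)" using h' opn by (simp add: height_Suc)
        show "height w (Suc p) \<le> height w s" if "Suc p \<le> s \<and> s \<le> r'" for s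
          using before[of s] that r' opn by (simp add: height_Suc)
      qed
      moreover have "balanced (map (\<lambda>s. fst (w ! s)) [r..<q])"
        using r less.prems by (intro less.hyps) auto
      moreover have "[p..<q] = p # [Suc p..<r'] @ r' # [r..<q]"
      proof -
        have "[p..<q] = [p..<r'] @ [r'..<q]"
          by (metis upt_add_eq_append le_add_diff_inverse less_imp_le r r' Suc_leD)
        then show ?thesis using r r' by (simp add: upt_conv_Cons)
      qed
      ultimately show ?thesis
        using balanced.intros(2) opn cls by simp
    qed
  qed
qed

lemma matched_iff_heights:
  "matched w p q \<longleftrightarrow> p < q \<and> q < length w \<and> fst (w ! p) = Open \<and> fst (w ! q) = Close \<and>
     height w (Suc q) = height w p \<and> (\<forall>s. p < s \<and> s \<le> q \<longrightarrow> height w p < height w s)"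
proof (cases "p < q \<and> q < length w \<and> fst (w ! p) = Open \<and> fst (w ! q) = Close")
  case True
  then have "balanced (map (\<lambda>s. fst (w ! s)) [p + 1..<q]) \<longleftrightarrow>
    height w q = height w (Suc p) \<and> (\<forall>s. Suc p \<le> s \<and> s \<le> q \<longrightarrow> height w (Suc p) \<le> height w s)"
    using balanced_segment_iff[of "Suc p" q w] by simp
  then show ?thesis using True by (auto simp: matched_def height_Suc Suc_le_eq add1_zle_eq)
qed (auto simp: matched_def)

lemma matched_unique:
  assumes "matched w p q" and "matched w p' q'"
  shows "p = p' \<longleftrightarrow> q = q'"
proof
  show "q = q'" if "p = p'"
  proof (rule ccontr)
    assume "q \<noteq> q'"
    then consider "q < q'" | "q' < q" by linarith
    then show False
      using assms that unfolding matched_iff_heights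
      by cases (metis Suc_leI less_SucI less_irrefl)+
  qed
  show "p = p'" if "q = q'"
  proof (rule ccontr)
    assume "p \<noteq> p'"
    then consider "p < p'" | "p' < p" by linarith
    then show False
      using assms that unfolding matched_iff_heights
      by cases (metis less_imp_le less_irrefl)+
  qed
qed

text \<open>
  The unmatched closing brackets are the strict record lows of the height: if an earlier height is as
  low, then the last such place carries the partner.
\<close>

lemma unmatched_Close_iff:
  assumes "p < length w" and "fst (w ! p) = Close"
  shows "unmatched w p \<longleftrightarrow> (\<forall>t\<le>p. height w (Suc p) < height w t)"
proof
  assume un: "unmatched w p"
  show "\<forall>t\<le>p. height w (Suc p) < height w t"
  proof (rule ccontr)
    assume "\<not> ?thesis"
    then obtain t where t: "t \<le> p" "height w t \<le> height w (Suc p)" by auto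
    define s where "s = (GREATEST s. s \<le> p \<and> height w s \<le> height w (Suc p))"
    have s: "s \<le> p" "height w s \<le> height w (Suc p)"
      using GreatestI_nat[of "\<lambda>s. s \<le> p \<and> height w s \<le> height w (Suc p)" t p] t
      unfolding s_def by auto
    have after: "height w (Suc p) < height w r" if "s < r" "r \<le> p" for r
      using Greatest_le_nat[of "\<lambda>s. s \<le> p \<and> height w s \<le> height w (Suc p)" r p] that
      unfolding s_def by force
    have "s \<noteq> p" using s assms by (auto simp: height_Suc)
    then have "s < p" using s by simp
    then have "height w (Suc p) < height w (Suc s)" using after by simp
    then have "fst (w ! s) = Open" "height w s = height w (Suc p)"
      using s by (auto simp: height_Suc split: if_splits)
    then have "matched w s p"
      using \<open>s < p\<close> assms after by (simp add: matched_iff_heights)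
    then show False using un by (auto simp: unmatched_def)
  qed
next
  assume "\<forall>t\<le>p. height w (Suc p) < height w t"
  then have "\<not> matched w q p" for q
    unfolding matched_iff_heights by (metis less_imp_le less_irrefl)
  moreover have "\<not> matched w p q" for q
    using assms by (simp add: matched_def)
  ultimately show "unmatched w p"
    by (simp add: unmatched_def)
qed

text \<open>
  Dually, an opening bracket is matched by the first closing bracket that brings the height back to
  its level.
\<close>

lemma unmatched_Open_iff:
  assumes "p < length w" and "fst (w ! p) = Open"
  shows "unmatched w p \<longleftrightarrow> (\<forall>t. p < t \<and> t \<le> length w \<longrightarrow> height w p < height w t)"
proof
  assume un: "unmatched w p"
  show "\<forall>t. p < t \<and> t \<le> length w \<longrightarrow> height w p < height w t"
  proof (rule ccontr)
    assume "\<not> ?thesis"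
    then obtain t where t: "p < t" "t \<le> length w" "height w t \<le> height w p" by auto
    define s where "s = (LEAST s. p < s \<and> height w s \<le> height w p)"
    have s: "p < s" "height w s \<le> height w p" "s \<le> t"
      using LeastI[of "\<lambda>s. p < s \<and> height w s \<le> height w p" t]
        Least_le[of "\<lambda>s. p < s \<and> height w s \<le> height w p" t] t
      unfolding s_def by auto
    have before: "height w p < height w r" if "p < r" "r < s" for r
      using not_less_Least[of r "\<lambda>s. p < s \<and> height w s \<le> height w p"] that
      unfolding s_def by force
    obtain q where q: "s = Suc q" using s by (cases s) auto
    have "p \<noteq> q" using s q assms by (auto simp: height_Suc)
    then have "p < q" using s q by simp
    then have "height w p < height w q" using before q by simp
    then have "fst (w ! q) = Close" "height w (Suc q) = height w p"
      using s q by (auto simp: height_Suc split: if_splits) (metis bracket.exhaust)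
    then have "matched w p q"
      using \<open>p < q\<close> assms before q s t by (simp add: matched_iff_heights)
    then show False using un by (auto simp: unmatched_def)
  qed
next
  assume "\<forall>t. p < t \<and> t \<le> length w \<longrightarrow> height w p < height w t"
  then have "\<not> matched w p q" for q
    unfolding matched_iff_heights by (metis Suc_leI less_SucI less_irrefl)
  moreover have "\<not> matched w q p" for q
    using assms by (simp add: matched_def)
  ultimately show "unmatched w p"
    by (simp add: unmatched_def)
qed

section \<open>Bracket classes as chains\<close>

text \<open>
  The graph of a partial injection consists of paths and cycles, so two equivalent points are
  comparable along it.
\<close>

lemma equivclp_partial_injection:
  assumes fn: "\<And>x y z. R x y \<Longrightarrow> R x z \<Longrightarrow> y = z"
    and inj: "\<And>x y z. R x z \<Longrightarrow> R y z \<Longrightarrow> x = y"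
  shows "equivclp R p q \<longleftrightarrow> R\<^sup>*\<^sup>* p q \<or> R\<^sup>*\<^sup>* q p"
proof
  assume "equivclp R p q"
  then show "R\<^sup>*\<^sup>* p q \<or> R\<^sup>*\<^sup>* q p"
  proof (induction rule: equivclp_induct)
    case base
    show ?case by simp
  next
    case (step y z)
    then consider "R\<^sup>*\<^sup>* p y" "R y z" | "R\<^sup>*\<^sup>* p y" "R z y" | "R\<^sup>*\<^sup>* y p" "R y z" | "R\<^sup>*\<^sup>* y p" "R z y"
      by blast
    then show ?case
    proof cases
      case 1
      then show ?thesis by (meson rtranclp.rtrancl_into_rtrancl)
    next
      case 2
      from 2(1) show ?thesis
      proof (cases rule: rtranclp.cases)
        case rtrancl_refl
        then show ?thesis using 2 by auto
      next
        case (rtrancl_into_rtrancl b)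
        then show ?thesis using inj 2 by auto
      qed
    next
      case 3
      from 3(1) show ?thesis
      proof (cases rule: converse_rtranclpE)
        case base
        then show ?thesis using 3 by auto
      next
        case (step b)
        then show ?thesis using fn 3 by auto
      qed
    next
      case 4
      then show ?thesis by (meson converse_rtranclp_into_rtranclp)
    qed
  qed
next
  assume "R\<^sup>*\<^sup>* p q \<or> R\<^sup>*\<^sup>* q p"
  then show "equivclp R p q"
  proof
    show "equivclp R p q" if "R\<^sup>*\<^sup>* p q"
      using that by (rule rtranclp_into_equivclp)
    show "equivclp R p q" if "R\<^sup>*\<^sup>* q p"
      using that by (intro equivclp_sym[OF rtranclp_into_equivclp])
  qed
qed

text \<open>
  Matches and dashes, directed from left to right, form a partial injection: a match leads from an
  opening to a closing bracket, a dash from a closing to an opening one. The classes are therefore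
  chains that run through the word from left to right, and their first and last elements are the ends
  of these chains.
\<close>

locale cell_word =
  fixes w :: bracket_word
  assumes distinct_word: "distinct w"
    and dash_adjacent: "dashed w p q \<Longrightarrow> q = Suc p"
begin

definition link :: "nat \<Rightarrow> nat \<Rightarrow> bool" where
  "link p q \<longleftrightarrow> matched w p q \<or> dashed w p q"

lemma link_less: "link p q \<Longrightarrow> p < q \<and> q < length w"
  using dash_adjacent[of p q] by (auto simp: link_def matched_def dashed_def)

lemma link_fun: "link p q \<Longrightarrow> link p r \<Longrightarrow> q = r"
  unfolding link_def using matched_unique dash_adjacent
  by (metis bracket.distinct(1) dashed_def matched_def)

lemma link_inj: "link p r \<Longrightarrow> link q r \<Longrightarrow> p = q"
  unfolding link_def using matched_unique dash_adjacent
  by (metis bracket.distinct(1) dashed_def matched_def nat.inject)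

lemma chain_le: "link\<^sup>*\<^sup>* p q \<Longrightarrow> p \<le> q"
proof (induction rule: rtranclp_induct)
  case (step q r)
  then show ?case using link_less[of q r] by simp
qed simp

lemma classes_eq: "classes w = {{q. link\<^sup>*\<^sup>* p q \<or> link\<^sup>*\<^sup>* q p} | p. p < length w}"
proof -
  have eq: "(\<lambda>p q. matched w p q \<or> dashed w p q) = link"
    by (auto simp: link_def fun_eq_iff)
  have "equivclp link p q \<longleftrightarrow> link\<^sup>*\<^sup>* p q \<or> link\<^sup>*\<^sup>* q p" for p q
    by (rule equivclp_partial_injection) (auto intro: link_fun link_inj)
  then have "Collect (equivclp link p) = {q. link\<^sup>*\<^sup>* p q \<or> link\<^sup>*\<^sup>* q p}" for p
    by blast
  then show ?thesis unfolding classes_def eq by simp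
qed

lemma chain_length: "link\<^sup>*\<^sup>* p q \<Longrightarrow> p < length w \<Longrightarrow> q < length w"
proof (induction rule: rtranclp_induct)
  case (step q r)
  then show ?case using link_less[of q r] by simp
qed simp

lemma class_bounded:
  assumes "K \<in> classes w"
  shows "K \<subseteq> {..<length w} \<and> K \<noteq> {}"
proof -
  obtain p where p: "p < length w" and K: "K = {q. link\<^sup>*\<^sup>* p q \<or> link\<^sup>*\<^sup>* q p}"
    using assms unfolding classes_eq by blast
  have "q < length w" if "q \<in> K" for q
    using that p chain_length[of p q] chain_le[of q p] unfolding K by auto
  moreover have "p \<in> K" by (simp add: K)
  ultimately show ?thesis by blast
qed

lemma class_finite: "K \<in> classes w \<Longrightarrow> finite K"
  using class_bounded finite_subset by blast

lemma class_chain: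
  assumes "K \<in> classes w" and "p \<in> K" and "q \<in> K" and "p \<le> q"
  shows "link\<^sup>*\<^sup>* p q"
proof -
  have "equivclp link p q"
  proof -
    obtain r where "K = {q. equivclp link r q}"
      using assms(1) unfolding classes_def link_def by auto
    then have "equivclp link r p" "equivclp link r q" using assms by blast+
    then show ?thesis using equivclp_sym equivclp_trans by metis
  qed
  then have "link\<^sup>*\<^sup>* p q \<or> link\<^sup>*\<^sup>* q p"
    using equivclp_partial_injection[of link p q, OF link_fun link_inj] by simp
  then show ?thesis using assms(4) chain_le[of q p] by force
qed

lemma class_closed:
  assumes "K \<in> classes w" and "p \<in> K" and "link p q"
  shows "q \<in> K"
proof -
  obtain r where K: "K = {q. equivclp link r q}"
    using assms(1) unfolding classes_def link_def by auto
  then have "equivclp link r p" using assms(2) by blast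
  then have "equivclp link r q" using equivclp_into_equivclp assms(3) by metis
  then show ?thesis by (simp add: K)
qed

text \<open>
  This is how the end of a class is recognised: there, a closing bracket carries no dash and an
  opening bracket is unmatched.
\<close>

lemma class_Max_no_link:
  assumes "K \<in> classes w"
  shows "\<not> link (Max K) q"
proof
  assume l: "link (Max K) q"
  have "q \<in> K" using class_closed[OF assms _ l] Max_in class_finite class_bounded assms by blast
  then have "q \<le> Max K" using class_finite assms by simp
  then show False using link_less[OF l] by simp
qed

lemma unmatched_Close_class:
  assumes "p < length w" and "fst (w ! p) = Close" and "unmatched w p"
  obtains K where "K \<in> classes w" and "p \<in> K" and "Min K = p" and "begins_unmatched w K"
    and "K = {q. link\<^sup>*\<^sup>* p q}"
proof
  have no_pred: "\<not> link q p" for q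
    using assms by (auto simp: link_def unmatched_def dashed_def)
  then have "q = p" if "link\<^sup>*\<^sup>* q p" for q
    using that by (metis rtranclp.cases)
  then show "{q. link\<^sup>*\<^sup>* p q} \<in> classes w"
    unfolding classes_eq using assms(1) by blast
  then show "Min {q. link\<^sup>*\<^sup>* p q} = p"
    using class_finite chain_le by (intro Min_eqI) auto
  then show "begins_unmatched w {q. link\<^sup>*\<^sup>* p q}"
    using assms by (simp add: begins_unmatched_def)
qed auto

text \<open>
  A chain that leaves a closing bracket stays on the level just below it: every match leaves this
  level upwards and comes back to it, and the dashed cells are the only places where the chain touches
  the level in between. For an unmatched initial bracket this level is a record low.
\<close>

lemma chain_levels:
  assumes "p < length w" and "fst (w ! p) = Close" and "link\<^sup>*\<^sup>* p q"
  shows "height w (if fst (w ! q) = Close then Suc q else q) = height w (Suc p)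
    \<and> (\<forall>t. p < t \<and> t \<le> q \<longrightarrow> height w (Suc p) \<le> height w t \<and>
          (height w t = height w (Suc p) \<longrightarrow> dashed w (t - 1) t))"
  using assms(3)
proof (induction rule: rtranclp_induct)
  case base
  then show ?case using assms by auto
next
  case (step q r)
  show ?case
  proof (cases "matched w q r")
    case True
    have "height w (Suc p) \<le> height w t \<and> (height w t = height w (Suc p) \<longrightarrow> dashed w (t - 1) t)"
      if "p < t" "t \<le> r" for t
    proof (cases "t \<le> q")
      case False
      then have "height w q < height w t"
        using True that by (simp add: matched_iff_heights)
      then show ?thesis using step True by (auto simp: matched_iff_heights)
    qed (use step that in blast)
    then show ?thesis using step True by (auto simp: matched_iff_heights)
  next
    case False
    then have d: "dashed w q r" using step by (simp add: link_def)
    then have "r = Suc q" by (rule dash_adjacent)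
    then show ?thesis using step d by (auto simp: dashed_def le_Suc_eq)
  qed
qed

end

section \<open>Combined classes and the minimum of the height\<close>

text \<open>
  Equivalently, the minimum of the height over all places of the word is smaller than its minimum over
  the cell boundaries, the two ends of the word included.
\<close>

definition minimum_inside_cells :: "bracket_word \<Rightarrow> bool" where
  "minimum_inside_cells w \<longleftrightarrow> (\<exists>t\<le>length w. (\<forall>s\<le>length w. height w t \<le> height w s) \<and>
     (\<forall>s\<le>length w. height w s = height w t \<longrightarrow> 0 < s \<and> dashed w (s - 1) s))"

context cell_word
begin

text \<open>
  Before the initial bracket of a combined class the height is above the level of the chain, since
  that bracket is a record low; along the chain it is at least this level; after the final unmatched
  opening bracket it stays above. So the level is the global minimum, and it is attained on dashes
  only.
\<close>

lemma combined_class_position: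
  assumes "K \<in> combined_classes w"
  shows "Min K < length w" and "fst (w ! Min K) = Close" and "dashed w (Min K) (Suc (Min K))"
    and "\<forall>t\<le>Min K. height w (Suc (Min K)) < height w t"
    and "\<forall>t\<le>length w. height w (Suc (Min K)) \<le> height w t"
    and "minimum_inside_cells w"
proof -
  define p q where "p = Min K" and "q = Max K"
  have K: "K \<in> classes w" and p: "fst (w ! p) = Close" "unmatched w p"
    and q: "fst (w ! q) = Open" "unmatched w q"
    using assms by (auto simp: combined_classes_def begins_unmatched_def ends_unmatched_def p_def q_def)
  have pK: "p \<in> K" and qK: "q \<in> K"
    using K class_finite class_bounded Min_in Max_in unfolding p_def q_def by blast+
  have len: "p < length w" "q < length w" using pK qK K class_bounded by blast+
  have "p \<le> q" using pK K class_finite by (simp add: q_def)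
  have chain: "link\<^sup>*\<^sup>* p q" using class_chain K pK qK \<open>p \<le> q\<close> by blast
  have before: "\<forall>t\<le>p. height w (Suc p) < height w t"
    using unmatched_Close_iff p len by blast
  have lev: "height w q = height w (Suc p)"
    and mid: "\<forall>t. p < t \<and> t \<le> q \<longrightarrow> height w (Suc p) \<le> height w t \<and>
          (height w t = height w (Suc p) \<longrightarrow> dashed w (t - 1) t)"
    using chain_levels[OF len(1) p(1) chain] q by simp_all
  have after: "\<forall>t. q < t \<and> t \<le> length w \<longrightarrow> height w (Suc p) < height w t"
    using unmatched_Open_iff q len lev by simp
  show all: "\<forall>t\<le>length w. height w (Suc (Min K)) \<le> height w t"
    using before mid after unfolding p_def by (meson less_imp_le not_le)
  show "Min K < length w" "fst (w ! Min K) = Close"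
    "\<forall>t\<le>Min K. height w (Suc (Min K)) < height w t"
    using p len before by (auto simp: p_def)
  have "p \<noteq> q" using p q by auto
  then have "p < q" using \<open>p \<le> q\<close> by simp
  then show "dashed w (Min K) (Suc (Min K))"
    using mid[rule_format, of "Suc p"] lev before by (simp flip: p_def)
  have "0 < s \<and> dashed w (s - 1) s" if "s \<le> length w" "height w s = height w (Suc p)" for s
  proof -
    have "p < s" "s \<le> q"
      using before after that by (metis less_irrefl not_le)+
    then show ?thesis using mid that by auto
  qed
  then show "minimum_inside_cells w"
    unfolding minimum_inside_cells_def using all len
    by (intro exI[of _ "Suc p"] conjI) (simp_all add: p_def)
qed

text \<open>
  Conversely, the first place where the minimum is attained is preceded by an unmatched closing
  bracket. Its chain moves along the minimal level; if that level is attained on dashes only, then the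
  chain cannot stop at a closing bracket, so that it ends with an unmatched opening one.
\<close>

lemma combined_class_iff: "combined_classes w \<noteq> {} \<longleftrightarrow> minimum_inside_cells w"
proof
  assume "combined_classes w \<noteq> {}"
  then show "minimum_inside_cells w" using combined_class_position(6) by blast
next
  assume "minimum_inside_cells w"
  then obtain t0 where t0: "t0 \<le> length w" "\<forall>s\<le>length w. height w t0 \<le> height w s"
    "\<forall>s\<le>length w. height w s = height w t0 \<longrightarrow> 0 < s \<and> dashed w (s - 1) s"
    unfolding minimum_inside_cells_def by blast
  define t where "t = (LEAST t. height w t = height w t0)"
  have t: "height w t = height w t0" "t \<le> t0"
    unfolding t_def using LeastI[of "\<lambda>t. height w t = height w t0" t0]
      Least_le[of "\<lambda>t. height w t = height w t0" t0] by simp_all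
  have first: "height w s \<noteq> height w t0" if "s < t" for s
    using not_less_Least that unfolding t_def by blast
  obtain p where p: "t = Suc p" using t t0 by (cases t) auto
  have "dashed w p t" using t t0 p by (metis diff_Suc_1 le_trans)
  then have cl: "p < length w" "fst (w ! p) = Close" by (auto simp: dashed_def)
  have "unmatched w p"
  proof (unfold unmatched_Close_iff[OF cl], intro allI impI)
    fix s assume "s \<le> p"
    then have "s < t" "s \<le> length w" using p t t0 by auto
    then show "height w (Suc p) < height w s"
      using first[of s] t0(2) t p by (simp add: order_less_le)
  qed
  with cl obtain K where K: "K \<in> classes w" "p \<in> K" "Min K = p" "begins_unmatched w K"
    "K = {q. link\<^sup>*\<^sup>* p q}" by (rule unmatched_Close_class)
  define q where "q = Max K"
  have "q \<in> K" unfolding q_def using K Max_in class_finite by blast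
  then have chain: "link\<^sup>*\<^sup>* p q" and len: "q < length w" using K class_bounded by blast+
  have stop: "\<not> link q r" for r
    using class_Max_no_link[OF K(1)] q_def by blast
  have "fst (w ! q) = Open"
  proof (rule ccontr)
    assume "fst (w ! q) \<noteq> Open"
    then have "fst (w ! q) = Close" by (metis bracket.exhaust)
    then have "height w (Suc q) = height w t0"
      using chain_levels[OF cl chain] p t by simp
    then have "dashed w q (Suc q)" using t0(3)[rule_format, of "Suc q"] len by simp
    then show False using stop by (auto simp: link_def)
  qed
  moreover have "unmatched w q"
    using stop calculation by (simp add: unmatched_def link_def matched_def)
  ultimately have "K \<in> combined_classes w"
    using K by (simp add: combined_classes_def ends_unmatched_def q_def)
  then show "combined_classes w \<noteq> {}" by blast
qed

lemma first_combined_class: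
  assumes "combined_classes w \<noteq> {}"
  obtains p where "p < length w" and "fst (w ! p) = Close" and "dashed w p (Suc p)"
    and "\<forall>t\<le>p. height w (Suc p) < height w t" and "\<forall>t\<le>length w. height w (Suc p) \<le> height w t"
    and "initial_cell w Close (first_class (combined_classes w)) = snd (w ! p)"
proof -
  define K where "K = first_class (combined_classes w)"
  have K: "K \<in> combined_classes w"
    unfolding K_def first_class_def using assms arg_min_natI[of "\<lambda>K. K \<in> combined_classes w"] by blast
  have fin: "finite K" and ne: "K \<noteq> {}"
    using K class_finite class_bounded by (auto simp: combined_classes_def)
  have "Min {p \<in> K. fst (w ! p) = Close} = Min K"
    using fin ne Min_in[OF fin ne] combined_class_position(2)[OF K] by (intro Min_eqI) auto
  then show thesis
    using that[of "Min K"] combined_class_position[OF K] by (auto simp: initial_cell_def K_def)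
qed

text \<open>
  If there is no combined class, the last class of right form lies on the minimal level: a lower level
  would first be reached at an unmatched closing bracket further right, and the class of that bracket
  would again be of right form. The final bracket of the class carries no dash, and all earlier visits to
  the minimum are on dashes.
\<close>

lemma last_right_class:
  assumes "combined_classes w = {}" and "right_classes w \<noteq> {}"
  obtains p where "p < length w" and "fst (w ! p) = Close" and "\<not> dashed w p (Suc p)"
    and "\<forall>t\<le>length w. height w (Suc p) \<le> height w t"
    and "\<forall>t\<le>p. height w t = height w (Suc p) \<longrightarrow> 0 < t \<and> dashed w (t - 1) t"
    and "final_cell w Close (last_class (right_classes w)) = snd (w ! p)"
proof -
  define K where "K = last_class (right_classes w)"
  have bdd: "\<forall>K. K \<in> right_classes w \<longrightarrow> Max K < length w"
    using class_bounded class_finite Max_in by (fastforce simp: right_classes_def)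
  obtain K0 where K0: "K0 \<in> right_classes w" using assms by blast
  have KR: "K \<in> right_classes w"
    unfolding K_def last_class_def
    by (rule arg_max_natI[where P = "\<lambda>K. K \<in> right_classes w", OF K0 bdd])
  have last: "Max K' \<le> Max K" if "K' \<in> right_classes w" for K'
    unfolding K_def last_class_def
    by (rule arg_max_nat_le[where P = "\<lambda>K. K \<in> right_classes w", OF that bdd])
  define p e where "p = Min K" and "e = Max K"
  have K: "K \<in> classes w" and p: "fst (w ! p) = Close" "unmatched w p"
    and ne: "\<not> ends_unmatched w K"
    using KR by (auto simp: right_classes_def begins_unmatched_def p_def)
  have fin: "finite K" and nonempty: "K \<noteq> {}" using K class_finite class_bounded by auto
  have pK: "p \<in> K" and eK: "e \<in> K"
    using fin nonempty Min_in Max_in unfolding p_def e_def by blast+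
  have len: "p < length w" "e < length w" using pK eK K class_bounded by blast+
  have "p \<le> e" using pK fin by (simp add: e_def)
  have chain: "link\<^sup>*\<^sup>* p e" using class_chain K pK eK \<open>p \<le> e\<close> by blast
  have stop: "\<not> link e r" for r
    using class_Max_no_link[OF K] e_def by blast
  have e: "fst (w ! e) = Close"
  proof (rule ccontr)
    assume "fst (w ! e) \<noteq> Close"
    then have o: "fst (w ! e) = Open" by (metis bracket.exhaust)
    then have "\<not> unmatched w e" using ne by (simp add: ends_unmatched_def e_def)
    then obtain r where "matched w e r \<or> matched w r e" by (auto simp: unmatched_def)
    moreover have "\<not> matched w r e" using o by (simp add: matched_def)
    ultimately show False using stop by (simp add: link_def)
  qed
  have before: "\<forall>t\<le>p. height w (Suc p) < height w t"
    using unmatched_Close_iff p len by blast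
  have lev: "height w (Suc e) = height w (Suc p)"
    and mid: "\<forall>t. p < t \<and> t \<le> e \<longrightarrow> height w (Suc p) \<le> height w t \<and>
          (height w t = height w (Suc p) \<longrightarrow> dashed w (t - 1) t)"
    using chain_levels[OF len(1) p(1) chain] e by auto
  have until: "height w (Suc e) \<le> height w t" if "t \<le> Suc e" for t
    using before mid that lev by (metis le_Suc_eq less_imp_le not_le order_refl)
  have min: "\<forall>t\<le>length w. height w (Suc e) \<le> height w t"
  proof (rule ccontr)
    assume "\<not> ?thesis"
    then obtain t where t: "t \<le> length w" "height w t < height w (Suc e)" by auto
    define s where "s = (LEAST s. height w s < height w (Suc e))"
    have s: "height w s < height w (Suc e)" "s \<le> t"
      unfolding s_def using t LeastI[of "\<lambda>s. height w s < height w (Suc e)" t]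
        Least_le[of "\<lambda>s. height w s < height w (Suc e)" t] by simp_all
    have sb: "height w (Suc e) \<le> height w r" if "r < s" for r
      using not_less_Least[of r "\<lambda>s. height w s < height w (Suc e)"] that unfolding s_def by force
    have "Suc e < s" using until s by (metis not_le)
    then obtain r where r: "s = Suc r" "e < r" by (cases s) auto
    have "height w (Suc r) < height w r" using sb[of r] s r by simp
    then have cl: "fst (w ! r) = Close"
      by (auto simp: height_Suc split: if_splits) (metis bracket.exhaust)
    have rl: "r < length w" using r s t by simp
    have "unmatched w r"
      using unmatched_Close_iff[OF rl cl] s r sb by (metis le_imp_less_Suc less_le_trans)
    with rl cl obtain K' where K': "K' \<in> classes w" "r \<in> K'" "begins_unmatched w K'"
      by (rule unmatched_Close_class)
    then have "K' \<in> right_classes w"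
      using assms(1) by (auto simp: right_classes_def combined_classes_def)
    then have "Max K' \<le> e" using last by (simp add: e_def)
    moreover have "r \<le> Max K'" using K' class_finite by simp
    ultimately show False using r by simp
  qed
  have "Max {p \<in> K. fst (w ! p) = Close} = e"
    using fin eK e by (intro Max_eqI) (auto simp: e_def)
  moreover have "0 < t \<and> dashed w (t - 1) t" if "t \<le> e" "height w t = height w (Suc e)" for t
  proof -
    have "p < t" using before that lev by (metis less_irrefl not_le)
    then show ?thesis using mid that lev by auto
  qed
  ultimately show thesis
    using that[of e] len e stop min by (auto simp: final_cell_def K_def link_def)
qed

end

section \<open>Removing and inserting a bracket at the minimum\<close>

text \<open>
  Removing the first bracket that reaches the minimum raises all later heights by one. The new minimum
  is therefore attained where the bracket was removed, which is a cell boundary.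
\<close>

lemma delete_initial_Close:
  assumes w: "w = u @ (Close, x) # v" and dist: "distinct w"
    and first: "\<forall>t\<le>length u. height w (Suc (length u)) < height w t"
    and min: "\<forall>t\<le>length w. height w (Suc (length u)) \<le> height w t"
    and dash: "dashed w (length u) (Suc (length u))"
  shows "\<not> minimum_inside_cells (u @ v)"
proof
  let ?m = "height w (Suc (length u))" and ?p = "length u"
  assume "minimum_inside_cells (u @ v)"
  then obtain t where t: "t \<le> length (u @ v)" "\<forall>s\<le>length (u @ v). height (u @ v) t \<le> height (u @ v) s"
    "\<forall>s\<le>length (u @ v). height (u @ v) s = height (u @ v) t \<longrightarrow> 0 < s \<and> dashed (u @ v) (s - 1) s"
    unfolding minimum_inside_cells_def by blast
  have hw: "height w (?p + Suc k) = height (u @ v) (?p + k) - 1" for k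
  proof -
    have "height ((Close, x) # v) (Suc k) = height v k - 1"
      using height_append_right[of "[(Close, x)]" v k] by (simp add: height_Suc)
    then show ?thesis unfolding w height_append_right by simp
  qed
  have hu: "height w s = height (u @ v) s" if "s \<le> ?p" for s
    using that w by (simp add: height_append_left)
  have ge: "?m + 1 \<le> height (u @ v) s" if "s \<le> length (u @ v)" for s
  proof (cases "s \<le> ?p")
    case True
    then show ?thesis using first hu by force
  next
    case False
    then obtain k where k: "s = ?p + k" by (metis le_add_diff_inverse nat_le_linear)
    have "?p + Suc k \<le> length w" using that k by (simp add: w)
    then have "?m \<le> height w (?p + Suc k)" using min by blast
    then show ?thesis unfolding hw[of k] k by simp
  qed
  \<comment> \<open>At a minimal place \<open>length u\<close> the word \<open>u @ v\<close> would need a dash, hence a bracket of the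
    same cell \<open>x\<close> just before the removed one.\<close>
  have "height (u @ v) ?p = ?m + 1" using hw[of 0] by simp
  moreover have "height (u @ v) t \<le> height (u @ v) ?p" using t(2) by simp
  ultimately have "height (u @ v) ?p = height (u @ v) t" using ge[OF t(1)] by linarith
  then have d: "0 < ?p" "dashed (u @ v) (?p - 1) ?p" using t(3) by auto
  have "snd ((u @ v) ! ?p) = x"
    using dash d unfolding w by (auto simp: dashed_def nth_append)
  then have "(u @ v) ! (?p - 1) = (Close, x)"
    using d by (auto simp: dashed_def prod_eq_iff)
  then have "u ! (?p - 1) = (Close, x)" using d(1) by (simp add: nth_append)
  moreover have "u ! (?p - 1) \<in> set u" using d(1) by (intro nth_mem) simp
  ultimately have "(Close, x) \<in> set u" by metis
  then show False using dist w by simp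
qed

text \<open>
  An opening bracket inserted at the first undashed place of minimal height turns this place into a
  dashed one and lifts everything after it above the minimum; the earlier visits to the minimum are on
  dashes already.
\<close>

lemma insert_final_Open:
  assumes w: "w = u @ (Close, x) # v"
    and min: "\<forall>t\<le>length w. height w (Suc (length u)) \<le> height w t"
    and first: "\<forall>t\<le>length u. height w t = height w (Suc (length u)) \<longrightarrow> 0 < t \<and> dashed w (t - 1) t"
  shows "minimum_inside_cells (u @ (Close, x) # (Open, x) # v)"
proof -
  let ?w = "u @ (Close, x) # (Open, x) # v" and ?p = "length u"
  define u' where "u' = u @ [(Close, x)]"
  have w': "w = u' @ v" "?w = u' @ (Open, x) # v" and lu: "length u' = Suc ?p"
    by (simp_all add: u'_def w)
  have left: "height ?w s = height w s" if "s \<le> Suc ?p" for s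
    unfolding w' using that lu by (simp add: height_append_left)
  have right: "height ?w (Suc ?p + Suc k) = height w (Suc ?p + k) + 1" for k
  proof -
    have "height ((Open, x) # v) (Suc k) = height v k + 1"
      using height_append_right[of "[(Open, x)]" v k] by (simp add: height_Suc)
    then show ?thesis unfolding w' lu[symmetric] height_append_right by simp
  qed
  have gt: "height w (Suc ?p) < height ?w s" if s: "s \<le> length ?w" "Suc ?p < s" for s
  proof -
    obtain k where "s = Suc (Suc ?p + k)" using less_imp_Suc_add[OF s(2)] by blast
    then have k: "s = Suc ?p + Suc k" by simp
    then have "Suc ?p + k \<le> length w" using s(1) by (simp add: w)
    then have "height w (Suc ?p) \<le> height w (Suc ?p + k)" using min by blast
    then show ?thesis unfolding k right by simp
  qed
  have "height ?w (Suc ?p) \<le> height ?w s" if "s \<le> length ?w" for s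
  proof (cases "s \<le> Suc ?p")
    case True
    then show ?thesis using left min w by simp
  next
    case False
    then show ?thesis using gt[OF that] left by simp
  qed
  moreover have "0 < s \<and> dashed ?w (s - 1) s"
    if "s \<le> length ?w" "height ?w s = height ?w (Suc ?p)" for s
  proof -
    have "s \<le> Suc ?p" using gt[OF that(1)] that(2) left by force
    then consider "s \<le> ?p" | "s = Suc ?p" by linarith
    then show ?thesis
    proof cases
      case 1
      then have "0 < s" "dashed w (s - 1) s" using first left that by auto
      then show ?thesis using 1 by (auto simp: w dashed_def nth_append)
    next
      case 2
      then show ?thesis by (auto simp: dashed_def nth_append)
    qed
  qed
  ultimately show ?thesis
    unfolding minimum_inside_cells_def by (intro exI[of _ "Suc ?p"]) auto
qed

section \<open>Excess along a double string\<close>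

lemma distinct_concat_map:
  assumes "distinct xs" and "\<And>x. x \<in> set xs \<Longrightarrow> distinct (f x)"
    and "\<And>x y. x \<in> set xs \<Longrightarrow> y \<in> set xs \<Longrightarrow> x \<noteq> y \<Longrightarrow> set (f x) \<inter> set (f y) = {}"
  shows "distinct (concat (map f xs))"
  using assms
proof (induction xs)
  case (Cons x xs)
  have "set (f x) \<inter> set (f y) = {}" if "y \<in> set xs" for y
    using Cons.prems(1) that by (intro Cons.prems(3)) auto
  then have "set (f x) \<inter> set (concat (map f xs)) = {}" by auto
  moreover have "distinct (concat (map f xs))"
    using Cons.prems by (intro Cons.IH) auto
  ultimately show ?case using Cons.prems(2)[of x] by simp
qed simp

lemma distinct_reading_order: "distinct (reading_order n lam)"
  unfolding reading_order_def
  by (rule distinct_concat_map) (auto simp: distinct_map inj_on_def)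

lemma distinct_bracket_word: "distinct (bracket_word n lam i T)"
  unfolding bracket_word_def
  by (rule distinct_concat_map[OF distinct_reading_order]) (auto simp: cell_brackets_def)

lemma bracket_word_split:
  assumes "x \<in> set (reading_order n lam)"
  obtains u v where "bracket_word n lam i T = u @ cell_brackets i T x @ v"
    and "\<And>S. bracket_word n lam i (T(x := S)) = u @ cell_brackets i (T(x := S)) x @ v"
proof -
  obtain as bs where ro: "reading_order n lam = as @ x # bs"
    using assms by (meson split_list)
  then have nin: "x \<notin> set as" "x \<notin> set bs"
    using distinct_reading_order[of n lam] by auto
  have same: "map (cell_brackets i (T(x := S))) zs = map (cell_brackets i T) zs"
    if "x \<notin> set zs" for zs S
    using that by (auto simp: cell_brackets_def)
  show thesis
    by (rule that[of "concat (map (cell_brackets i T) as)" "concat (map (cell_brackets i T) bs)"])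
      (simp_all add: bracket_word_def ro same nin del: map_eq_conv)
qed

lemma bracket_word_at_Close:
  assumes "p < length (bracket_word n lam i T)" and "fst (bracket_word n lam i T ! p) = Close"
    and "snd (bracket_word n lam i T ! p) = x"
  obtains u v where "p = length u" and "i \<in> T x"
    and "bracket_word n lam i T = u @ (Close, x) # (if i + 1 \<in> T x then [(Open, x)] else []) @ v"
    and "\<And>S. bracket_word n lam i (T(x := S)) =
      u @ (if i \<in> S then [(Close, x)] else []) @ (if i + 1 \<in> S then [(Open, x)] else []) @ v"
proof -
  let ?w = "bracket_word n lam i T"
  have at: "?w ! p = (Close, x)" using assms by (simp add: prod_eq_iff)
  then have "(Close, x) \<in> set ?w" using assms(1) by (metis nth_mem)
  then have x: "x \<in> set (reading_order n lam)" "i \<in> T x"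
    by (auto simp: bracket_word_def cell_brackets_def split: if_splits)
  obtain u v where split: "?w = u @ cell_brackets i T x @ v"
    "\<And>S. bracket_word n lam i (T(x := S)) = u @ cell_brackets i (T(x := S)) x @ v"
    by (rule bracket_word_split[OF x(1), where i = i and T = T]) blast
  have w: "?w = u @ (Close, x) # (if i + 1 \<in> T x then [(Open, x)] else []) @ v"
    using split(1) x(2) by (simp add: cell_brackets_def)
  have "?w ! length u = (Close, x)" "length u < length ?w" unfolding w by simp_all
  then have "p = length u"
    using at assms(1) distinct_bracket_word nth_eq_iff_index_eq by metis
  then show thesis
    using that[OF _ x(2) w] split(2) by (simp add: cell_brackets_def)
qed

lemma cell_word_bracket_word: "cell_word (bracket_word n lam i T)"
proof
  show "distinct (bracket_word n lam i T)" by (rule distinct_bracket_word)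
next
  let ?w = "bracket_word n lam i T"
  fix p q assume d: "dashed ?w p q"
  define x where "x = snd (?w ! p)"
  have len: "p < length ?w" "q < length ?w" and cl: "fst (?w ! p) = Close"
    and q: "?w ! q = (Open, x)"
    using d by (auto simp: dashed_def x_def prod_eq_iff)
  then have "(Open, x) \<in> set ?w" by (metis nth_mem)
  then have x: "i + 1 \<in> T x"
    by (auto simp: bracket_word_def cell_brackets_def split: if_splits)
  obtain u v where u: "p = length u"
    and w: "?w = u @ (Close, x) # (if i + 1 \<in> T x then [(Open, x)] else []) @ v"
    by (rule bracket_word_at_Close[OF len(1) cl x_def[symmetric]]) blast
  have "?w ! Suc p = (Open, x)" "Suc p < length ?w" unfolding w u using x by (simp_all add: nth_append)
  then show "q = Suc p"
    using q len distinct_bracket_word nth_eq_iff_index_eq by metis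
qed

lemma finite_cells: "finite (cells n lam)"
proof (rule finite_subset)
  show "cells n lam \<subseteq> (SIGMA r:{1..n}. {1..lam r})" by (auto simp: cells_def)
qed auto

lemma ex_update:
  assumes "x \<in> cells n lam"
  shows "ex n lam (T(x := S)) + (card (T x) - 1) = ex n lam T + (card S - 1)"
proof -
  have "(\<Sum>y\<in>cells n lam - {x}. card ((T(x := S)) y) - 1) = (\<Sum>y\<in>cells n lam - {x}. card (T y) - 1)"
    by (rule sum.cong) auto
  then show ?thesis
    unfolding ex_def using sum.remove[OF finite_cells assms, of "\<lambda>y. card (T y) - 1"]
      sum.remove[OF finite_cells assms, of "\<lambda>y. card ((T(x := S)) y) - 1"] by simp
qed

lemma SVT_cell:
  assumes "T \<in> SVT n lam" and "k \<in> T x"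
  shows "x \<in> cells n lam"
  using assms unfolding SVT_def by blast

lemma SVT_entry:
  assumes "T \<in> SVT n lam" and "x \<in> cells n lam"
  shows "T x \<noteq> {}" and "finite (T x)" and "T x \<subseteq> {1..n}"
proof -
  show "T x \<noteq> {}" and sub: "T x \<subseteq> {1..n}"
    using assms unfolding SVT_def by blast+
  show "finite (T x)" using sub finite_subset by blast
qed

text \<open>
  The operator alternates between its two modes: a deletion destroys the combined class, and an
  insertion creates one.
\<close>

lemma f_op_deletes:
  assumes T: "T \<in> SVT n lam" and T': "T' \<in> SVT n lam"
    and f: "f_op n lam i T = Some T'" and comb: "combined_classes (bracket_word n lam i T) \<noteq> {}"
  shows "combined_classes (bracket_word n lam i T') = {} \<and> ex n lam T = ex n lam T' + 1"
proof -
  interpret cell_word "bracket_word n lam i T" by (rule cell_word_bracket_word)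
  let ?w = "bracket_word n lam i T"
  from comb obtain p where p: "p < length ?w" "fst (?w ! p) = Close" "dashed ?w p (Suc p)"
    and first: "\<forall>t\<le>p. height ?w (Suc p) < height ?w t"
    and min: "\<forall>t\<le>length ?w. height ?w (Suc p) \<le> height ?w t"
    and init: "initial_cell ?w Close (first_class (combined_classes ?w)) = snd (?w ! p)"
    by (rule first_combined_class)
  define x where "x = snd (?w ! p)"
  have T'_eq: "T' = T(x := T x - {i})"
    using f comb init by (simp add: f_op_def Let_def x_def)
  obtain u v where u: "p = length u" and ix: "i \<in> T x"
    and w: "?w = u @ (Close, x) # (if i + 1 \<in> T x then [(Open, x)] else []) @ v"
    and upd: "\<And>S. bracket_word n lam i (T(x := S)) =
      u @ (if i \<in> S then [(Close, x)] else []) @ (if i + 1 \<in> S then [(Open, x)] else []) @ v"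
    by (rule bracket_word_at_Close[OF p(1,2) x_def[symmetric]]) blast
  have "bracket_word n lam i T' = u @ (if i + 1 \<in> T x then [(Open, x)] else []) @ v"
    unfolding T'_eq upd by simp
  moreover have "\<not> minimum_inside_cells (u @ (if i + 1 \<in> T x then [(Open, x)] else []) @ v)"
    using w distinct_word first min p(3) unfolding u by (rule delete_initial_Close)
  ultimately have "combined_classes (bracket_word n lam i T') = {}"
    using cell_word.combined_class_iff[OF cell_word_bracket_word] by metis
  moreover have "ex n lam T = ex n lam T' + 1"
  proof -
    have x: "x \<in> cells n lam" using SVT_cell[OF T ix] .
    have "T' x \<noteq> {}" "finite (T' x)" using SVT_entry[OF T' x] by auto
    then have "card (T x - {i}) > 0" using T'_eq by (simp add: card_gt_0_iff)
    then show ?thesis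
      using ex_update[OF x, of T "T x - {i}"] ix T'_eq by (simp add: card_Diff_singleton)
  qed
  ultimately show ?thesis by blast
qed

lemma f_op_inserts:
  assumes T: "T \<in> SVT n lam"
    and f: "f_op n lam i T = Some T'" and comb: "combined_classes (bracket_word n lam i T) = {}"
  shows "combined_classes (bracket_word n lam i T') \<noteq> {} \<and> ex n lam T' = ex n lam T + 1"
proof -
  interpret cell_word "bracket_word n lam i T" by (rule cell_word_bracket_word)
  let ?w = "bracket_word n lam i T"
  have "right_classes ?w \<noteq> {}"
    using f comb by (auto simp: f_op_def Let_def)
  with comb obtain p where p: "p < length ?w" "fst (?w ! p) = Close" "\<not> dashed ?w p (Suc p)"
    and min: "\<forall>t\<le>length ?w. height ?w (Suc p) \<le> height ?w t"
    and first: "\<forall>t\<le>p. height ?w t = height ?w (Suc p) \<longrightarrow> 0 < t \<and> dashed ?w (t - 1) t"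
    and final: "final_cell ?w Close (last_class (right_classes ?w)) = snd (?w ! p)"
    by (rule last_right_class)
  define x where "x = snd (?w ! p)"
  have T'_eq: "T' = T(x := insert (i + 1) (T x))"
    using f comb final \<open>right_classes ?w \<noteq> {}\<close> by (simp add: f_op_def Let_def x_def)
  obtain u v where u: "p = length u" and ix: "i \<in> T x"
    and w: "?w = u @ (Close, x) # (if i + 1 \<in> T x then [(Open, x)] else []) @ v"
    and upd: "\<And>S. bracket_word n lam i (T(x := S)) =
      u @ (if i \<in> S then [(Close, x)] else []) @ (if i + 1 \<in> S then [(Open, x)] else []) @ v"
    by (rule bracket_word_at_Close[OF p(1,2) x_def[symmetric]]) blast
  have new: "i + 1 \<notin> T x"
  proof
    assume "i + 1 \<in> T x"
    then have "dashed ?w p (Suc p)"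
      unfolding w u by (simp add: dashed_def nth_append)
    then show False using p(3) by blast
  qed
  have w0: "?w = u @ (Close, x) # v" using w new by simp
  have "bracket_word n lam i T' = u @ (Close, x) # (Open, x) # v"
    unfolding T'_eq upd using ix by simp
  moreover have "minimum_inside_cells (u @ (Close, x) # (Open, x) # v)"
    using w0 min first unfolding u by (rule insert_final_Open)
  ultimately have "combined_classes (bracket_word n lam i T') \<noteq> {}"
    using cell_word.combined_class_iff[OF cell_word_bracket_word] by metis
  moreover have "ex n lam T' = ex n lam T + 1"
  proof -
    have x: "x \<in> cells n lam" using SVT_cell[OF T ix] .
    have "T x \<noteq> {}" "finite (T x)" using SVT_entry[OF T x] by auto
    then have "card (T x) > 0" by (simp add: card_gt_0_iff)
    then show ?thesis
      using ex_update[OF x, of T "insert (i + 1) (T x)"] new T'_eq \<open>finite (T x)\<close> by simp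
  qed
  ultimately show ?thesis by blast
qed

text \<open>
  The vanishing of \<open>e_op\<close> at the start excludes a combined class there. From then on a combined class is
  present exactly at the odd steps, and the vanishing of \<open>f_op\<close> at the end excludes one there, so that
  the last index is even.
\<close>

lemma double_string_excess:
  assumes "double_string n lam i T m"
  shows "even m" and "\<forall>j\<le>m. ex n lam (T j) = ex n lam (T 0) + j mod 2"
proof -
  have SVT: "T j \<in> SVT n lam" if "j \<le> m" for j
    using assms that by (simp add: double_string_def)
  have step: "f_op n lam i (T j) = Some (T (Suc j))" if "j < m" for j
    using assms that by (simp add: double_string_def)
  have inv: "(combined_classes (bracket_word n lam i (T j)) \<noteq> {} \<longleftrightarrow> odd j) \<and>
    ex n lam (T j) = ex n lam (T 0) + j mod 2" if "j \<le> m" for j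
    using that
  proof (induction j)
    case 0
    have "e_op n lam i (T 0) = None" using assms by (simp add: double_string_def)
    then show ?case by (auto simp: e_op_def Let_def split: if_splits)
  next
    case (Suc j)
    then have j: "j < m" "j \<le> m" by auto
    show ?case
    proof (cases "odd j")
      case True
      then have "combined_classes (bracket_word n lam i (T (Suc j))) = {} \<and>
          ex n lam (T j) = ex n lam (T (Suc j)) + 1"
        using f_op_deletes[OF SVT SVT step] Suc.IH Suc.prems j by blast
      moreover have "j mod 2 = 1" "Suc j mod 2 = 0" using True by (simp_all add: odd_iff_mod_2_eq_one mod_Suc)
      ultimately show ?thesis using Suc.IH[OF j(2)] True by simp
    next
      case False
      then have "combined_classes (bracket_word n lam i (T (Suc j))) \<noteq> {} \<and>
          ex n lam (T (Suc j)) = ex n lam (T j) + 1"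
        using f_op_inserts[OF SVT step] Suc.IH j by blast
      moreover have "j mod 2 = 0" "Suc j mod 2 = 1" using False by (simp_all add: mod_Suc even_iff_mod_2_eq_zero)
      ultimately show ?thesis using Suc.IH[OF j(2)] False by simp
    qed
  qed
  have "f_op n lam i (T m) = None" using assms by (simp add: double_string_def)
  then have "combined_classes (bracket_word n lam i (T m)) = {}"
    by (auto simp: f_op_def Let_def split: if_splits)
  then show "even m" using inv[of m] by simp
  show "\<forall>j\<le>m. ex n lam (T j) = ex n lam (T 0) + j mod 2" using inv by blast
qed

section \<open>Enhanced Gelfand--Zetlin patterns\<close>

text \<open>
  What the computation of the dimension needs from the pattern of a tableau. The set
  \<open>U\<close> consists of the positions that are not encircled; the strict inequality at such a position leaves
  room for its coordinate to vary.
\<close>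

locale enhanced_pattern =
  fixes n :: nat and a :: "nat \<Rightarrow> nat \<Rightarrow> int" and U :: "(nat \<times> nat) set"
  assumes U_coord: "U \<subseteq> coord_positions n"
    and left_le: "(Suc i, j) \<in> coord_positions n \<Longrightarrow> a i j \<le> a (Suc i) j"
    and le_right: "(Suc i, j) \<in> coord_positions n \<Longrightarrow> a (Suc i) j \<le> a i (j + 1)"
    and left_less_U: "(Suc i, j) \<in> U \<Longrightarrow> a i j < a (Suc i) j"
begin

definition edges_upto :: "nat \<Rightarrow> ((nat \<times> nat) \<times> (nat \<times> nat)) set" where
  "edges_upto i = edges n a (positions n - U) i"

definition up :: "nat \<Rightarrow> nat \<Rightarrow> (nat \<times> nat) set" where
  "up i j = up_targets a (positions n - U) (edges_upto (i - 1)) i j"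

definition connected_in :: "nat \<Rightarrow> nat \<times> nat \<Rightarrow> nat \<times> nat \<Rightarrow> bool" where
  "connected_in i p q \<longleftrightarrow> (p, q) \<in> (edges_upto i \<union> (edges_upto i)\<inverse>)\<^sup>*"

lemma edges_upto_0: "edges_upto 0 = {((0, j), (0, j + 1)) | j. 1 \<le> j \<and> j < n \<and> a 0 j = a 0 (j + 1)}"
  by (simp add: edges_upto_def)

lemma edges_upto_Suc:
  "edges_upto (Suc i) = edges_upto i \<union> {((Suc i, j), p) | j p. (Suc i, j) \<in> coord_positions n \<and> p \<in> up (Suc i) j}"
  by (auto simp: edges_upto_def up_def coord_positions_def)

lemma up_free: "(i, j) \<in> U \<Longrightarrow> up i j = {}"
  by (simp add: up_def up_targets_def)

lemma up_bound:
  assumes "(Suc i, j) \<in> coord_positions n" and "(Suc i, j) \<notin> U"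
  shows "up (Suc i) j =
    (if a (Suc i) j = a i (j + 1) then
       (if a (Suc i) j = a i j \<and> connected_in i (i, j) (i, j + 1)
        then {(i, j), (i, j + 1)} else {(i, j + 1)})
     else if a (Suc i) j = a i j then {(i, j)} else {})"
  using assms by (auto simp: up_def up_targets_def connected_in_def coord_positions_def)

lemma up_subset: "up (Suc i) j \<subseteq> {(i, j), (i, j + 1)}"
  by (auto simp: up_def up_targets_def)

lemma up_value:
  "(k, l) \<in> up (Suc i) j \<Longrightarrow> a k l = a (Suc i) j"
  by (auto simp: up_def up_targets_def split: if_splits)

lemma connected_in_edge: "(p, q) \<in> edges_upto i \<Longrightarrow> connected_in i p q \<and> connected_in i q p"
  by (auto simp: connected_in_def)

lemma connected_in_trans: "connected_in i p q \<Longrightarrow> connected_in i q r \<Longrightarrow> connected_in i p r"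
  by (auto simp: connected_in_def)

text \<open>
  The array with free values \<open>u\<close> at the positions that start a new component and zero in row \<open>0\<close>,
  propagated downwards along the edges.
\<close>

primrec extend :: "(nat \<Rightarrow> nat \<Rightarrow> real) \<Rightarrow> nat \<Rightarrow> nat \<Rightarrow> real" where
  "extend u 0 = (\<lambda>j. 0)"
| "extend u (Suc i) = (\<lambda>j. if up (Suc i) j = {} then u (Suc i) j
     else if (i, j + 1) \<in> up (Suc i) j then extend u i (j + 1) else extend u i j)"

text \<open>
  A position is joined to two entries only if these are already connected, and then they carry the same
  value by induction; this is why \<open>extend\<close> may use just one of them.
\<close>

lemma extend_edge: "((i, j), (k, l)) \<in> edges_upto m \<Longrightarrow> extend u i j = extend u k l"
proof (induction m arbitrary: i j k l)
  case 0
  then show ?case by (auto simp: edges_upto_0)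
next
  case (Suc m)
  have connected: "extend u (fst p) (snd p) = extend u (fst q) (snd q)" if "connected_in m p q" for p q
    using that unfolding connected_in_def
  proof (induction rule: rtrancl_induct)
    case (step q r)
    then show ?case
      using Suc.IH[of "fst q" "snd q" "fst r" "snd r"] Suc.IH[of "fst r" "snd r" "fst q" "snd q"] by auto
  qed simp
  show ?case
  proof (cases "((i, j), (k, l)) \<in> edges_upto m")
    case True
    then show ?thesis by (rule Suc.IH)
  next
    case False
    then have i: "i = Suc m" and pos: "(Suc m, j) \<in> coord_positions n" and kl: "(k, l) \<in> up (Suc m) j"
      using Suc.prems by (auto simp: edges_upto_Suc)
    have "(Suc m, j) \<notin> U" using kl up_free by auto
    then show ?thesis
      using kl connected[of "(m, j)" "(m, j + 1)"] i by (auto simp: up_bound[OF pos] split: if_splits)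
  qed
qed

lemma extend_up:
  "(Suc i, j) \<in> coord_positions n \<Longrightarrow> (k, l) \<in> up (Suc i) j \<Longrightarrow> extend u (Suc i) j = extend u k l"
  by (rule extend_edge[of _ _ _ _ "Suc i"]) (simp add: edges_upto_Suc)

text \<open>
  An array that is constant along edges, zero on the components with a prescribed value, and larger on
  those free components that start in a lower row; the denominator keeps it below \<open>1\<close>.
\<close>

definition slack :: "nat \<Rightarrow> nat \<Rightarrow> real" where
  "slack = extend (\<lambda>i j. if (i, j) \<in> U then real i / real (n + 1) else 0)"

lemma slack_bounds: "0 \<le> slack i j \<and> slack i j \<le> real i / real (n + 1)"
proof (induction i arbitrary: j)
  case (Suc i)
  have "real i / real (n + 1) \<le> real (Suc i) / real (n + 1)"
    by (simp add: divide_right_mono)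
  then show ?case
    using Suc.IH[of j] Suc.IH[of "j + 1"] by (auto simp: slack_def intro: order_trans)
qed (simp add: slack_def)

lemma slack_less_1:
  assumes "(i, j) \<in> positions n"
  shows "slack i j < 1"
proof -
  have "i < n + 1" using assms by (auto simp: positions_def)
  then have "real i / real (n + 1) < 1" by simp
  then show ?thesis using slack_bounds[of i j] by linarith
qed

lemma slack_U: "(Suc i, j) \<in> U \<Longrightarrow> slack (Suc i) j = real (Suc i) / real (n + 1)"
  by (simp add: slack_def up_free)

text \<open>
  The case that decides whether the inequalities leave the cell its full dimension: a position equal to both entries above it
  but joined to the right one alone. Interlacing forces the entry of the previous row between two equal
  neighbours to have the same value, and the right neighbour to be encircled. If the left neighbour is
  free, its component is younger. If it is encircled, it is joined to the entry between them while the
  right neighbour is joined further to the right, so that the same situation occurs one row higher.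
  In row \<open>0\<close> equal neighbours are connected.
\<close>

lemma slack_less_across:
  assumes "(i, j) \<in> positions n" and "(i, j + 1) \<in> positions n" and "a i j = a i (j + 1)"
    and "\<not> connected_in i (i, j) (i, j + 1)"
  shows "slack i (j + 1) < slack i j"
  using assms
proof (induction i arbitrary: j)
  case 0
  then have "((0, j), (0, j + 1)) \<in> edges_upto 0" by (auto simp: edges_upto_0 positions_def)
  then show ?case using 0 connected_in_edge by blast
next
  case (Suc i)
  have pos: "(Suc i, j) \<in> coord_positions n" "(Suc i, j + 1) \<in> coord_positions n"
    using Suc.prems by (auto simp: coord_positions_def)
  have eq: "a i (j + 1) = a (Suc i) j" "a i (j + 1) = a (Suc i) (j + 1)"
    using left_le[OF pos(2)] le_right[OF pos(1)] Suc.prems(3) by auto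
  then have nU: "(Suc i, j + 1) \<notin> U" using left_less_U by force
  have nonempty: "up (Suc i) (j + 1) \<noteq> {}"
    using eq up_bound[OF pos(2) nU] by simp
  show ?case
  proof (cases "(Suc i, j) \<in> U")
    case True
    have "slack (Suc i) (j + 1) \<le> real i / real (n + 1)"
      using nonempty slack_bounds[of i "j + 1"] slack_bounds[of i "j + 2"] by (simp add: slack_def)
    also have "\<dots> < slack (Suc i) j"
      by (simp add: slack_U[OF True] divide_strict_right_mono)
    finally show ?thesis .
  next
    case False
    have up1: "(i, j + 1) \<in> up (Suc i) j"
      using eq by (simp add: up_bound[OF pos(1) False])
    have edge1: "((Suc i, j), (i, j + 1)) \<in> edges_upto (Suc i)" using up1 pos by (auto simp: edges_upto_Suc)
    have "(i, j + 1) \<notin> up (Suc i) (j + 1)"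
    proof
      assume "(i, j + 1) \<in> up (Suc i) (j + 1)"
      then have "((Suc i, j + 1), (i, j + 1)) \<in> edges_upto (Suc i)" using pos by (auto simp: edges_upto_Suc)
      then show False
        using Suc.prems(4) edge1 connected_in_edge connected_in_trans by blast
    qed
    then have up2: "up (Suc i) (j + 1) = {(i, j + 2)}" and eq2: "a i (j + 1) = a i (j + 2)"
      and nc: "\<not> connected_in i (i, j + 1) (i, j + 2)"
      using eq up_bound[OF pos(2) nU] by (simp_all split: if_splits)
    have "slack i (j + 2) < slack i (j + 1)"
      using Suc.IH[of "j + 1"] eq2 nc pos by (auto simp: coord_positions_def positions_def)
    moreover have "slack (Suc i) j = slack i (j + 1)"
      unfolding slack_def using extend_up[OF pos(1) up1] .
    moreover have "slack (Suc i) (j + 1) = slack i (j + 2)"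
      unfolding slack_def using extend_up[OF pos(2)] up2 by simp
    ultimately show ?thesis by simp
  qed
qed

text \<open>
  The interior point of the cell, shown below to satisfy strictly every interlacing inequality that is
  not turned into an equation by an edge.
\<close>

definition centre :: "nat \<Rightarrow> nat \<Rightarrow> real" where
  "centre i j = real_of_int (a i j) - slack i j"

lemma coord_neighbours:
  assumes "(Suc i, j) \<in> coord_positions n"
  shows "(Suc i, j) \<in> positions n" and "(i, j) \<in> positions n" and "(i, j + 1) \<in> positions n"
  using assms by (auto simp: coord_positions_def positions_def)

lemma centre_0: "centre 0 j = a 0 j"
  by (simp add: centre_def slack_def)

lemma centre_up:
  assumes "(Suc i, j) \<in> coord_positions n" and "(k, l) \<in> up (Suc i) j"
  shows "centre (Suc i) j = centre k l"
proof -
  have "slack (Suc i) j = slack k l" unfolding slack_def by (rule extend_up[OF assms])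
  then show ?thesis using up_value[OF assms(2)] by (simp add: centre_def)
qed

lemma centre_fixed:
  assumes "(Suc i, j) \<notin> U" and "up (Suc i) j = {}"
  shows "centre (Suc i) j = a (Suc i) j"
  using assms by (simp add: centre_def slack_def)

lemma centre_less:
  assumes "a i j < a k l" and "(k, l) \<in> positions n"
  shows "centre i j < centre k l"
proof -
  have "real_of_int (a i j) + 1 \<le> a k l" using assms(1) by linarith
  then show ?thesis
    using slack_bounds[of i j] slack_less_1[OF assms(2)] by (simp add: centre_def)
qed

lemma centre_U:
  assumes "(Suc i, j) \<in> U"
  shows "a (Suc i) j - 1 < centre (Suc i) j" and "centre (Suc i) j < a (Suc i) j"
    and "centre i j < centre (Suc i) j" and "centre (Suc i) j < centre i (j + 1)"
proof -
  have c: "(Suc i, j) \<in> coord_positions n" using assms U_coord by blast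
  note pos = coord_neighbours[OF c]
  show "a (Suc i) j - 1 < centre (Suc i) j"
    using slack_less_1[OF pos(1)] by (simp add: centre_def)
  show "centre (Suc i) j < a (Suc i) j"
    by (simp add: centre_def slack_U[OF assms])
  show "centre i j < centre (Suc i) j"
    using left_less_U[OF assms] pos by (intro centre_less)
  have "slack i (j + 1) \<le> real i / real (n + 1)" using slack_bounds by blast
  also have "\<dots> < slack (Suc i) j"
    by (simp add: slack_U[OF assms] divide_strict_right_mono)
  finally show "centre (Suc i) j < centre i (j + 1)"
    using le_right[OF c] by (simp add: centre_def)
qed

lemma centre_left:
  assumes "(Suc i, j) \<in> coord_positions n"
  shows "(i, j) \<in> up (Suc i) j \<or> centre i j < centre (Suc i) j"
proof (cases "(Suc i, j) \<in> U")
  case True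
  then show ?thesis using centre_U by blast
next
  case False
  note pos = coord_neighbours[OF assms]
  show ?thesis
  proof (cases "a i j < a (Suc i) j")
    case True
    then show ?thesis using centre_less pos by blast
  next
    case le: False
    then have eq: "a (Suc i) j = a i j" using left_le[OF assms] by simp
    show ?thesis
    proof (cases "(i, j) \<in> up (Suc i) j")
      case out: False
      then have up: "up (Suc i) j = {(i, j + 1)}" and "a i j = a i (j + 1)"
        and "\<not> connected_in i (i, j) (i, j + 1)"
        using eq by (auto simp: up_bound[OF assms False] split: if_splits)
      then have "centre i j < centre i (j + 1)"
        using slack_less_across[of i j] pos by (simp add: centre_def)
      then show ?thesis using centre_up[OF assms] up by simp
    qed simp
  qed
qed

lemma centre_right:
  assumes "(Suc i, j) \<in> coord_positions n"
  shows "(i, j + 1) \<in> up (Suc i) j \<or> centre (Suc i) j < centre i (j + 1)"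
proof (cases "(Suc i, j) \<in> U")
  case True
  then show ?thesis using centre_U by blast
next
  case False
  show ?thesis
  proof (cases "a (Suc i) j = a i (j + 1)")
    case True
    then show ?thesis by (auto simp: up_bound[OF assms False])
  next
    case ne: False
    then have "a (Suc i) j < a i (j + 1)" using le_right[OF assms] by simp
    then show ?thesis using centre_less coord_neighbours[OF assms] by blast
  qed
qed

end

section \<open>The dimension of a cell\<close>

lemma open_Collect_Ball_finite:
  assumes "finite I" and "\<And>x. x \<in> I \<Longrightarrow> open {y. P x y}"
  shows "open {y. \<forall>x\<in>I. P x y}"
proof -
  have "{y. \<forall>x\<in>I. P x y} = (\<Inter>x\<in>I. {y. P x y})" by auto
  then show ?thesis using assms by (simp add: open_INT)
qed

lemma open_Collect_if:
  assumes "b \<Longrightarrow> open {y. P y}" and "\<not> b \<Longrightarrow> open {y. Q y}"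
  shows "open {y. if b then P y else Q y}"
  using assms by (cases b) simp_all

lemma finite_coord_positions: "finite (coord_positions n)"
  by (rule finite_subset[of _ "{..n} \<times> {..n}"]) (auto simp: coord_positions_def positions_def)

lemma coord_positions_Suc: "p \<in> coord_positions n \<Longrightarrow> \<exists>i j. p = (Suc i, j)"
  by (cases p; cases "fst p") (auto simp: coord_positions_def)

lemma continuous_on_gz_entry: "continuous_on UNIV (\<lambda>y. gz_entry n lam idx y i j)"
  by (cases "i = 0") (auto simp: gz_entry_def intro!: continuous_intros)

locale gz_geometry = enhanced_pattern n a U
  for n and a :: "nat \<Rightarrow> nat \<Rightarrow> int" and U +
  fixes lam :: "nat \<Rightarrow> nat" and idx :: "nat \<times> nat \<Rightarrow> 'm::finite"
  assumes idx: "bij_betw idx (coord_positions n) UNIV"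
    and row_0: "1 \<le> j \<Longrightarrow> j \<le> n \<Longrightarrow> a 0 j = int (lam (n + 1 - j))"
begin

abbreviation Y :: "real ^ 'm \<Rightarrow> nat \<Rightarrow> nat \<Rightarrow> real" where
  "Y \<equiv> gz_entry n lam idx"

definition direction_entry :: "real ^ 'm \<Rightarrow> nat \<Rightarrow> nat \<Rightarrow> real" where
  "direction_entry v i j = (if i = 0 then 0 else v $ idx (i, j))"

definition vector_of :: "(nat \<Rightarrow> nat \<Rightarrow> real) \<Rightarrow> real ^ 'm" where
  "vector_of h = (\<chi> m. case inv_into (coord_positions n) idx m of (i, j) \<Rightarrow> h i j)"

text \<open>
  The cell is cut out by \<open>equations\<close> and the open conditions \<open>free_bounds\<close>. On the affine space of the
  equations, \<open>strict_interlacing\<close> is an open part of the polytope, because each of the remaining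
  interlacing inequalities is an equality along an edge. The linear space \<open>directions\<close> is that of the
  homogeneous equations.
\<close>

definition equations :: "(real ^ 'm) set" where
  "equations = {y. \<forall>i j. (Suc i, j) \<in> coord_positions n \<longrightarrow>
     (\<forall>k l. (k, l) \<in> up (Suc i) j \<longrightarrow> Y y (Suc i) j = Y y k l) \<and>
     (up (Suc i) j = {} \<and> (Suc i, j) \<notin> U \<longrightarrow> Y y (Suc i) j = a (Suc i) j)}"

definition directions :: "(real ^ 'm) set" where
  "directions = {v. \<forall>i j. (Suc i, j) \<in> coord_positions n \<longrightarrow>
     (\<forall>k l. (k, l) \<in> up (Suc i) j \<longrightarrow> direction_entry v (Suc i) j = direction_entry v k l) \<and>
     (up (Suc i) j = {} \<and> (Suc i, j) \<notin> U \<longrightarrow> direction_entry v (Suc i) j = 0)}"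

definition free_bounds :: "(real ^ 'm) set" where
  "free_bounds = {y. \<forall>(i, j) \<in> U.
     (if a i j - a (i - 1) j \<ge> 2 then a i j - 1 < Y y i j else Y y (i - 1) j < Y y i j) \<and>
     (if a (i - 1) (j + 1) = a i j then Y y i j < Y y (i - 1) (j + 1) else Y y i j < a i j)}"

definition strict_interlacing :: "(real ^ 'm) set" where
  "strict_interlacing = {y. \<forall>(i, j) \<in> coord_positions n.
     ((i - 1, j) \<notin> up i j \<longrightarrow> Y y (i - 1) j < Y y i j) \<and>
     ((i - 1, j + 1) \<notin> up i j \<longrightarrow> Y y i j < Y y (i - 1) (j + 1))}"

lemma finite_U: "finite U"
  using U_coord finite_coord_positions by (rule finite_subset)

lemma vector_of_nth: "(i, j) \<in> coord_positions n \<Longrightarrow> vector_of h $ idx (i, j) = h i j"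
  using idx by (simp add: vector_of_def bij_betw_def inv_into_f_f)

lemma positions_cases: "(i, j) \<in> positions n \<Longrightarrow> i = 0 \<and> 1 \<le> j \<and> j \<le> n \<or> (i, j) \<in> coord_positions n"
  by (cases i) (auto simp: positions_def coord_positions_def)

lemma up_positions:
  assumes "(Suc i, j) \<in> coord_positions n" and "(k, l) \<in> up (Suc i) j"
  shows "(k, l) \<in> positions n"
  using up_subset[of i j] coord_neighbours[OF assms(1)] assms(2) by auto

lemma Y_centre_plus:
  assumes "(i, j) \<in> positions n"
  shows "Y (vector_of centre + v) i j = centre i j + direction_entry v i j"
  using positions_cases[OF assms] row_0[of j] centre_0[of j]
  by (auto simp: gz_entry_def direction_entry_def vector_of_nth) (simp add: coord_positions_def)

lemma Y_centre: "(i, j) \<in> positions n \<Longrightarrow> Y (vector_of centre) i j = centre i j"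
  using Y_centre_plus[of i j 0] by (simp add: direction_entry_def)

lemma centre_plus_in_equations_iff: "vector_of centre + v \<in> equations \<longleftrightarrow> v \<in> directions"
proof -
  have "Y (vector_of centre + v) (Suc i) j = Y (vector_of centre + v) k l \<longleftrightarrow>
      direction_entry v (Suc i) j = direction_entry v k l"
    if "(Suc i, j) \<in> coord_positions n" "(k, l) \<in> up (Suc i) j" for i j k l
    using up_positions[OF that] centre_up[OF that] coord_neighbours(1)[OF that(1)]
    by (simp add: Y_centre_plus)
  moreover have "Y (vector_of centre + v) (Suc i) j = a (Suc i) j \<longleftrightarrow> direction_entry v (Suc i) j = 0"
    if "(Suc i, j) \<in> coord_positions n" "up (Suc i) j = {} \<and> (Suc i, j) \<notin> U" for i j
    using that centre_fixed[of i j] coord_neighbours(1)[OF that(1)] by (simp add: Y_centre_plus)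
  ultimately show ?thesis
    unfolding equations_def directions_def mem_Collect_eq by (metis (no_types, lifting))
qed

lemma equations_eq: "equations = (+) (vector_of centre) ` directions"
proof
  show "equations \<subseteq> (+) (vector_of centre) ` directions"
  proof
    fix y assume y: "y \<in> equations"
    have "y = vector_of centre + (y - vector_of centre)" by simp
    then show "y \<in> (+) (vector_of centre) ` directions"
      using y centre_plus_in_equations_iff by (metis imageI)
  qed
  show "(+) (vector_of centre) ` directions \<subseteq> equations"
    using centre_plus_in_equations_iff by auto
qed

lemma direction_entry_linear:
  "direction_entry (v + w) i j = direction_entry v i j + direction_entry w i j"
  "direction_entry (c *\<^sub>R v) i j = c * direction_entry v i j"
  "direction_entry 0 i j = 0"
  by (simp_all add: direction_entry_def)

lemma subspace_directions: "subspace directions"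
  unfolding subspace_def directions_def
  by (simp add: direction_entry_linear case_prod_unfold)

text \<open>
  Proceeding row by row, an entry of a solution of the homogeneous equations is free, zero, or equal to
  an entry of the row above.
\<close>

lemma directions_determined:
  assumes v: "v \<in> directions" and zero: "\<And>p. p \<in> U \<Longrightarrow> v $ idx p = 0"
  shows "v = 0"
proof -
  have entry: "direction_entry v i j = 0" if "(i, j) \<in> positions n" for i j
    using that
  proof (induction i arbitrary: j)
    case 0
    show ?case by (simp add: direction_entry_def)
  next
    case (Suc i)
    then have c: "(Suc i, j) \<in> coord_positions n" by (simp add: coord_positions_def)
    consider "(Suc i, j) \<in> U" | "(Suc i, j) \<notin> U" "up (Suc i) j = {}"
      | k l where "(k, l) \<in> up (Suc i) j" by fast
    then show ?case
    proof cases
      case 1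
      then show ?thesis using zero by (simp add: direction_entry_def)
    next
      case 2
      then show ?thesis using v c by (auto simp: directions_def)
    next
      case 3
      then have "direction_entry v (Suc i) j = direction_entry v k l"
        using v c by (auto simp: directions_def)
      moreover have "k = i" using 3 up_subset[of i j] by auto
      ultimately show ?thesis using Suc.IH up_positions[OF c 3] by simp
    qed
  qed
  have "v $ m = 0" for m
  proof -
    obtain p where p: "p \<in> coord_positions n" "m = idx p"
      using idx bij_betw_imp_surj_on by blast
    obtain i j where ij: "p = (Suc i, j)" using coord_positions_Suc p by blast
    show ?thesis
      using entry[of "Suc i" j] p ij by (simp add: direction_entry_def coord_positions_def)
  qed
  then show ?thesis by (simp add: vec_eq_iff)
qed

lemma direction_entry_extend:
  assumes "(i, j) \<in> positions n"
  shows "direction_entry (vector_of (extend u)) i j = extend u i j"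
  using positions_cases[OF assms] by (auto simp: direction_entry_def vector_of_nth)

lemma extend_in_directions:
  assumes "\<And>i j. (i, j) \<notin> U \<Longrightarrow> u i j = 0"
  shows "vector_of (extend u) \<in> directions"
  unfolding directions_def
proof (intro CollectI allI impI conjI)
  fix i j assume c: "(Suc i, j) \<in> coord_positions n"
  show "direction_entry (vector_of (extend u)) (Suc i) j = direction_entry (vector_of (extend u)) k l"
    if "(k, l) \<in> up (Suc i) j" for k l
    using extend_up[OF c that] up_positions[OF c that] coord_neighbours(1)[OF c]
    by (simp only: direction_entry_extend)
  show "direction_entry (vector_of (extend u)) (Suc i) j = 0"
    if "up (Suc i) j = {} \<and> (Suc i, j) \<notin> U"
    using that assms coord_neighbours(1)[OF c] by (simp add: direction_entry_extend)
qed

text \<open>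
  Projection to the coordinates in \<open>U\<close> is injective by \<open>directions_determined\<close> and surjective by means of \<open>extend\<close>.
\<close>

lemma dim_directions: "dim directions = card U"
proof -
  define proj :: "real ^ 'm \<Rightarrow> real ^ 'm" where "proj v = (\<chi> m. if m \<in> idx ` U then v $ m else 0)" for v
  have lin: "linear proj"
    by (rule linearI) (auto simp: proj_def vec_eq_iff)
  have "v = 0" if "v \<in> directions" "proj v = 0" for v
  proof (rule directions_determined[OF that(1)])
    fix p assume "p \<in> U"
    then have "proj v $ idx p = v $ idx p" by (simp add: proj_def)
    then show "v $ idx p = 0" using that(2) by simp
  qed
  then have "inj_on proj directions"
    using linear_injective_on_subspace_0[OF lin subspace_directions] by blast
  then have "inj_on proj (span directions)"
    using subspace_directions by (metis span_eq_iff)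
  then have "dim (proj ` directions) = dim directions"
    by (rule dim_image_eq[OF lin])
  moreover have "proj ` directions = {x. \<forall>m. m \<notin> idx ` U \<longrightarrow> x $ m = 0}"
  proof
    show "proj ` directions \<subseteq> {x. \<forall>m. m \<notin> idx ` U \<longrightarrow> x $ m = 0}"
      by (auto simp: proj_def)
    show "{x. \<forall>m. m \<notin> idx ` U \<longrightarrow> x $ m = 0} \<subseteq> proj ` directions"
    proof
      fix x :: "real ^ 'm" assume x: "x \<in> {x. \<forall>m. m \<notin> idx ` U \<longrightarrow> x $ m = 0}"
      define u where "u i j = (if (i, j) \<in> U then x $ idx (i, j) else 0)" for i j
      have "proj (vector_of (extend u)) $ m = x $ m" for m
      proof (cases "m \<in> idx ` U")
        case True
        then obtain p where p: "p \<in> U" "m = idx p" by blast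
        then obtain i j where ij: "p = (Suc i, j)" using U_coord coord_positions_Suc by blast
        then have "vector_of (extend u) $ m = x $ m"
          using p U_coord by (auto simp: vector_of_nth up_free u_def)
        then show ?thesis using True by (simp add: proj_def)
      next
        case False
        then show ?thesis using x by (simp add: proj_def)
      qed
      then have "x = proj (vector_of (extend u))" by (simp add: vec_eq_iff)
      moreover have "vector_of (extend u) \<in> directions"
        by (rule extend_in_directions) (simp add: u_def)
      ultimately show "x \<in> proj ` directions" by blast
    qed
  qed
  moreover have "card (idx ` U) = card U"
    using idx U_coord by (intro card_image) (auto simp: bij_betw_def intro: inj_on_subset)
  ultimately show ?thesis
    using dim_substandard_cart[of "idx ` U", where 'a = real] by (simp add: dim_vec_eq)
qed

lemma affine_equations: "affine equations"
  unfolding equations_eq using affine_translation subspace_imp_affine[OF subspace_directions] by blast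

lemma aff_dim_equations: "aff_dim equations = int (card U)"
  unfolding equations_eq aff_dim_translation_eq aff_dim_subspace[OF subspace_directions] dim_directions ..

lemma open_free_bounds: "open free_bounds"
  unfolding free_bounds_def split_beta
  by (intro open_Collect_Ball_finite finite_U open_Collect_conj open_Collect_if open_Collect_less
      continuous_on_gz_entry continuous_on_const)

lemma open_strict_interlacing: "open strict_interlacing"
  unfolding strict_interlacing_def split_beta imp_conv_disj
  by (intro open_Collect_Ball_finite finite_coord_positions open_Collect_conj open_Collect_disj
      open_Collect_const open_Collect_less continuous_on_gz_entry)

lemma centre_in_equations: "vector_of centre \<in> equations"
  using centre_plus_in_equations_iff[of 0] subspace_0[OF subspace_directions] by simp

lemma centre_in_free_bounds: "vector_of centre \<in> free_bounds"
  unfolding free_bounds_def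
proof (intro CollectI ballI)
  fix p assume p: "p \<in> U"
  then obtain i j where ij: "p = (Suc i, j)" using U_coord coord_positions_Suc by blast
  then have c: "(Suc i, j) \<in> coord_positions n" and U: "(Suc i, j) \<in> U" using p U_coord by auto
  show "case p of (i, j) \<Rightarrow>
     (if a i j - a (i - 1) j \<ge> 2 then a i j - 1 < Y (vector_of centre) i j
      else Y (vector_of centre) (i - 1) j < Y (vector_of centre) i j) \<and>
     (if a (i - 1) (j + 1) = a i j then Y (vector_of centre) i j < Y (vector_of centre) (i - 1) (j + 1)
      else Y (vector_of centre) i j < a i j)"
    using centre_U[OF U] coord_neighbours[OF c] unfolding ij by (simp add: Y_centre)
qed

lemma centre_in_strict_interlacing: "vector_of centre \<in> strict_interlacing"
  unfolding strict_interlacing_def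
proof (intro CollectI ballI)
  fix p assume p: "p \<in> coord_positions n"
  then obtain i j where ij: "p = (Suc i, j)" using coord_positions_Suc by blast
  then have c: "(Suc i, j) \<in> coord_positions n" using p by auto
  show "case p of (i, j) \<Rightarrow>
     ((i - 1, j) \<notin> up i j \<longrightarrow> Y (vector_of centre) (i - 1) j < Y (vector_of centre) i j) \<and>
     ((i - 1, j + 1) \<notin> up i j \<longrightarrow> Y (vector_of centre) i j < Y (vector_of centre) (i - 1) (j + 1))"
    using centre_left[OF c] centre_right[OF c] coord_neighbours[OF c] unfolding ij
    by (auto simp: Y_centre)
qed

lemma strict_interlacing_in_GZ: "equations \<inter> strict_interlacing \<subseteq> GZ n lam idx"
  unfolding GZ_def
proof (intro subsetI CollectI ballI)
  fix y p assume y: "y \<in> equations \<inter> strict_interlacing" and p: "p \<in> coord_positions n"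
  then obtain i j where ij: "p = (Suc i, j)" using coord_positions_Suc by blast
  then have c: "(Suc i, j) \<in> coord_positions n" using p by auto
  have eq: "Y y (Suc i) j = Y y k l" if "(k, l) \<in> up (Suc i) j" for k l
    using y c that by (auto simp: equations_def)
  have lt: "(i, j) \<notin> up (Suc i) j \<Longrightarrow> Y y i j < Y y (Suc i) j"
    "(i, j + 1) \<notin> up (Suc i) j \<Longrightarrow> Y y (Suc i) j < Y y i (j + 1)"
    using y c by (auto simp: strict_interlacing_def)
  have "Y y i j \<le> Y y (Suc i) j" using eq[of i j] lt(1) by fastforce
  moreover have "Y y (Suc i) j \<le> Y y i (j + 1)" using eq[of i "j + 1"] lt(2) by fastforce
  ultimately show "case p of (i, j) \<Rightarrow> Y y (i - 1) j \<le> Y y i j \<and> Y y i j \<le> Y y (i - 1) (j + 1)"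
    unfolding ij by simp
qed

text \<open>
  The centre satisfies the equations and all open conditions. So the cell contains a non-empty open
  subset of the solution space of the equations, and this space is also its affine span.
\<close>

lemma aff_dim_cell:
  defines "L \<equiv> affine hull (equations \<inter> free_bounds)"
  shows "aff_dim (equations \<inter> free_bounds \<inter> (top_of_set L) interior_of (GZ n lam idx \<inter> L)) = int (card U)"
    (is "aff_dim ?C = _")
proof -
  have L: "L = equations"
    unfolding L_def
    using affine_hull_affine_Int_open[OF affine_equations open_free_bounds]
      centre_in_equations centre_in_free_bounds affine_equations by (auto simp: hull_same)
  let ?O = "free_bounds \<inter> strict_interlacing"
  have "equations \<inter> strict_interlacing \<subseteq> (top_of_set L) interior_of (GZ n lam idx \<inter> L)"
    using strict_interlacing_in_GZ open_strict_interlacing unfolding L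
    by (intro interior_of_maximal) (auto simp: openin_open)
  then have "equations \<inter> ?O \<subseteq> ?C" by auto
  then have "aff_dim (equations \<inter> ?O) \<le> aff_dim ?C" by (rule aff_dim_subset)
  moreover have "aff_dim ?C \<le> aff_dim equations" by (rule aff_dim_subset) auto
  moreover have "affine hull (equations \<inter> ?O) = affine hull equations"
    using centre_in_equations centre_in_free_bounds centre_in_strict_interlacing
    by (intro affine_hull_affine_Int_open affine_equations open_Int open_free_bounds open_strict_interlacing) auto
  then have "aff_dim (equations \<inter> ?O) = aff_dim equations" by (rule aff_dim_affine_hull2)
  ultimately show ?thesis using aff_dim_equations by simp
qed

end

section \<open>The pattern of a set-valued tableau\<close>

lemma SVT_adjacent:
  assumes T: "T \<in> SVT n lam" and "(r, c) \<in> cells n lam" and x: "x \<in> T (r, c)"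
  shows SVT_right: "(r, c + 1) \<in> cells n lam \<Longrightarrow> y \<in> T (r, c + 1) \<Longrightarrow> x \<le> y"
    and SVT_below: "(r + 1, c) \<in> cells n lam \<Longrightarrow> y \<in> T (r + 1, c) \<Longrightarrow> x < y"
proof -
  have max: "x \<le> Max (T (r, c))"
    using SVT_entry(2)[OF T assms(2)] x by simp
  show "x \<le> y" if c: "(r, c + 1) \<in> cells n lam" and y: "y \<in> T (r, c + 1)"
  proof -
    have "Max (T (r, c)) \<le> Min (T (r, c + 1))" using T assms(2) c unfolding SVT_def by blast
    also have "\<dots> \<le> y" using SVT_entry(2)[OF T c] y by simp
    finally show ?thesis using max by simp
  qed
  show "x < y" if c: "(r + 1, c) \<in> cells n lam" and y: "y \<in> T (r + 1, c)"
  proof -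
    have "Max (T (r, c)) < Min (T (r + 1, c))" using T assms(2) c unfolding SVT_def by blast
    also have "\<dots> \<le> y" using SVT_entry(2)[OF T c] y by simp
    finally show ?thesis using max by simp
  qed
qed

lemma SVT_row:
  assumes T: "T \<in> SVT n lam" and "(r, c) \<in> cells n lam" and "x \<in> T (r, c)" and "c < c'"
    and "(r, c') \<in> cells n lam" and "y \<in> T (r, c')"
  shows "x \<le> y"
  using assms(4-6)
proof (induction c' arbitrary: y)
  case (Suc c')
  have c': "c = c' \<or> c < c'" using Suc.prems by auto
  have cell: "(r, c') \<in> cells n lam"
    using Suc.prems assms(2) c' by (auto simp: cells_def)
  obtain z where z: "z \<in> T (r, c')" using SVT_entry(1)[OF T cell] by blast
  have "x' \<le> y" if "x' \<in> T (r, c')" for x'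
    using SVT_right[OF T cell that, of y] Suc.prems by simp
  then show ?case using c' assms(3) Suc.IH[OF _ cell z] z by fastforce
qed simp

lemma row_le_letter:
  assumes T: "T \<in> SVT n lam" and lam: "is_partition n lam"
    and "(r, c) \<in> cells n lam" and "x \<in> T (r, c)"
  shows "r \<le> x"
  using assms(3,4)
proof (induction r arbitrary: x)
  case (Suc r)
  show ?case
  proof (cases "r = 0")
    case True
    then show ?thesis using SVT_entry(3)[OF T Suc.prems(1)] Suc.prems(2) by auto
  next
    case False
    have "lam (r + 1) \<le> lam r" using lam Suc.prems(1) False by (auto simp: is_partition_def cells_def)
    then have cell: "(r, c) \<in> cells n lam" using Suc.prems(1) False by (auto simp: cells_def)
    obtain y where y: "y \<in> T (r, c)" using SVT_entry(1)[OF T cell] by blast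
    have "y < x" using SVT_below[OF T cell y, of x] Suc.prems by simp
    then show ?thesis using Suc.IH[OF cell y] by simp
  qed
qed simp

lemma Min_le_iff_letter:
  assumes "T \<in> SVT n lam" and "x \<in> cells n lam"
  shows "Min (T x) \<le> k \<longleftrightarrow> (\<exists>l \<in> T x. l \<le> k)"
  using SVT_entry[OF assms] by (simp add: Min_le_iff)

lemma finite_nu: "finite {c. (r, c) \<in> cells n lam \<and> P c}"
  by (rule finite_subset[of _ "{1..lam r}"]) (auto simp: cells_def)

lemma nu_all:
  assumes "T \<in> SVT n lam" and "1 \<le> r" and "r \<le> n"
  shows "nu n lam T n r = lam r"
proof -
  have "Min (T (r, c)) \<le> n" if "(r, c) \<in> cells n lam" for c
    using SVT_entry(1,3)[OF assms(1) that] Min_le_iff_letter[OF assms(1) that] by fastforce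
  then have "{c. (r, c) \<in> cells n lam \<and> Min (T (r, c)) \<le> n} = {1..lam r}"
    using assms by (auto simp: cells_def)
  then show ?thesis by (simp add: nu_def)
qed

lemma nu_mono: "k \<le> k' \<Longrightarrow> nu n lam T k r \<le> nu n lam T k' r"
  unfolding nu_def by (rule card_mono[OF finite_nu]) auto

lemma nu_shifted_subset:
  assumes T: "T \<in> SVT n lam" and lam: "is_partition n lam" and r: "1 \<le> r"
  shows "{c. (r + 1, c) \<in> cells n lam \<and> Min (T (r + 1, c)) \<le> k + 1}
    \<subseteq> {c. (r, c) \<in> cells n lam \<and> Min (T (r, c)) \<le> k}"
proof
  fix c assume "c \<in> {c. (r + 1, c) \<in> cells n lam \<and> Min (T (r + 1, c)) \<le> k + 1}"
  then have c: "(r + 1, c) \<in> cells n lam" and "Min (T (r + 1, c)) \<le> k + 1" by auto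
  then obtain l where l: "l \<in> T (r + 1, c)" "l \<le> k + 1"
    using Min_le_iff_letter[OF T] by blast
  have "lam (r + 1) \<le> lam r" using lam c r by (auto simp: is_partition_def cells_def)
  then have cell: "(r, c) \<in> cells n lam" using c r by (auto simp: cells_def)
  obtain y where y: "y \<in> T (r, c)" using SVT_entry(1)[OF T cell] by blast
  have "y < l" using SVT_below[OF T cell y c l(1)] .
  then have "y \<le> k" using l by simp
  then have "Min (T (r, c)) \<le> k"
    unfolding Min_le_iff_letter[OF T cell] using y by blast
  then show "c \<in> {c. (r, c) \<in> cells n lam \<and> Min (T (r, c)) \<le> k}" using cell by simp
qed

text \<open>
  The strict inequality at a position in \<open>U\<close>: the column of a cell that contains \<open>k + 1\<close> as a non-minimal
  letter is counted for row \<open>r\<close>, but not for row \<open>r + 1\<close>, where all letters of this column exceed \<open>k + 1\<close>.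
\<close>

lemma nu_shifted_less:
  assumes T: "T \<in> SVT n lam" and lam: "is_partition n lam"
    and c: "(r, c) \<in> cells n lam" and l: "k + 1 \<in> T (r, c)" "k + 1 \<noteq> Min (T (r, c))"
  shows "nu n lam T (k + 1) (r + 1) < nu n lam T k r"
  unfolding nu_def
proof (rule psubset_card_mono[OF finite_nu], rule psubsetI)
  show "{c. (r + 1, c) \<in> cells n lam \<and> Min (T (r + 1, c)) \<le> k + 1}
    \<subseteq> {c. (r, c) \<in> cells n lam \<and> Min (T (r, c)) \<le> k}"
    using c by (intro nu_shifted_subset[OF T lam]) (auto simp: cells_def)
  have "Min (T (r, c)) \<le> k"
    using Min_le[OF SVT_entry(2)[OF T c] l(1)] l(2) by simp
  moreover have "\<not> Min (T (r + 1, c)) \<le> k + 1" if c': "(r + 1, c) \<in> cells n lam"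
  proof
    assume "Min (T (r + 1, c)) \<le> k + 1"
    then obtain l' where "l' \<in> T (r + 1, c)" "l' \<le> k + 1"
      using Min_le_iff_letter[OF T c'] by blast
    then show False using SVT_below[OF T c l(1) c'] by fastforce
  qed
  ultimately show "{c. (r + 1, c) \<in> cells n lam \<and> Min (T (r + 1, c)) \<le> k + 1}
    \<noteq> {c. (r, c) \<in> cells n lam \<and> Min (T (r, c)) \<le> k}" using c by blast
qed

lemma nonminimal_letter:
  assumes T: "T \<in> SVT n lam" and lam: "is_partition n lam"
    and c: "(r, c) \<in> cells n lam" and l: "l \<in> T (r, c)" "l \<noteq> Min (T (r, c))"
  shows "1 \<le> r" and "r < l" and "l \<le> n"
proof -
  note e = SVT_entry[OF T c]
  show "1 \<le> r" using c by (auto simp: cells_def)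
  show "l \<le> n" using e l by auto
  have "r \<le> Min (T (r, c))" using row_le_letter[OF T lam c] e Min_in by blast
  moreover have "Min (T (r, c)) < l" using Min_le[OF e(2) l(1)] l(2) by simp
  ultimately show "r < l" by simp
qed

lemma enhanced_pattern_SVT:
  assumes T: "T \<in> SVT n lam" and lam: "is_partition n lam"
  shows "enhanced_pattern n (pattern n lam T) (U_set n lam T)"
proof
  have U: "\<exists>k r c. i = n - k \<and> j = k + 1 - r \<and> 1 \<le> r \<and> r \<le> k \<and> 1 \<le> k \<and> k + 1 \<le> n \<and>
      (r, c) \<in> cells n lam \<and> k + 1 \<in> T (r, c) \<and> k + 1 \<noteq> Min (T (r, c))"
    if ij: "(i, j) \<in> U_set n lam T" for i j
  proof -
    obtain k r c where krc: "i = n - k" "j = k + 1 - r" "1 \<le> k" "(r, c) \<in> cells n lam"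
      "k + 1 \<in> T (r, c)" "k + 1 \<noteq> Min (T (r, c))"
      using ij unfolding U_set_def by blast
    then have "1 \<le> r" "r \<le> k" "k + 1 \<le> n"
      using nonminimal_letter[OF T lam krc(4-6)] by auto
    then show ?thesis using krc by blast
  qed
  show "U_set n lam T \<subseteq> coord_positions n"
  proof
    fix p assume p: "p \<in> U_set n lam T"
    obtain i j where ij: "p = (i, j)" by fastforce
    show "p \<in> coord_positions n"
      using U[of i j] p unfolding ij by (auto simp: coord_positions_def positions_def)
  qed
  show "pattern n lam T i j < pattern n lam T (Suc i) j" if ij: "(Suc i, j) \<in> U_set n lam T" for i j
  proof -
    obtain k r c where k: "Suc i = n - k" "j = k + 1 - r" "1 \<le> r" "r \<le> k" "1 \<le> k" "k + 1 \<le> n"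
      and c: "(r, c) \<in> cells n lam" "k + 1 \<in> T (r, c)" "k + 1 \<noteq> Min (T (r, c))"
      using U[OF ij] by blast
    have "n - i = k + 1" "n - Suc i = k" using k by auto
    moreover have "k + 1 + 1 - j = r + 1" "k + 1 - j = r" using k by auto
    ultimately show ?thesis
      unfolding pattern_def using nu_shifted_less[OF T lam c] by simp
  qed
  fix i j assume "(Suc i, j) \<in> coord_positions n"
  then have j: "Suc i \<le> n - 1" "1 \<le> j" "j \<le> n - Suc i"
    by (auto simp: coord_positions_def positions_def)
  define k r where "k = n - Suc i" and "r = k + 1 - j"
  have k: "n - i = k + 1" "n - Suc i = k" using j by (auto simp: k_def)
  have r: "k + 1 + 1 - j = r + 1" "k + 1 - j = r" "k + 1 + 1 - (j + 1) = r" "1 \<le> r"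
    using j by (auto simp: r_def k_def)
  have "nu n lam T (k + 1) (r + 1) \<le> nu n lam T k r"
    unfolding nu_def using nu_shifted_subset[OF T lam r(4)] by (rule card_mono[OF finite_nu])
  then show "pattern n lam T i j \<le> pattern n lam T (Suc i) j"
    unfolding pattern_def k r by simp
  show "pattern n lam T (Suc i) j \<le> pattern n lam T i (j + 1)"
    unfolding pattern_def k r by (simp add: nu_mono)
qed

text \<open>
  Since rows increase weakly, a letter is a non-minimal element of at most one cell of a given row. So
  the positions in \<open>U_set\<close> correspond to the pairs of a cell and a non-minimal letter in it, and the excess
  counts these pairs.
\<close>

lemma card_U_set:
  assumes T: "T \<in> SVT n lam" and lam: "is_partition n lam"
  shows "card (U_set n lam T) = ex n lam T"
proof -
  define N where "N = (SIGMA x:cells n lam. T x - {Min (T x)})"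
  define g where "g = (\<lambda>((r, c :: nat), l). (n - (l - 1), l - r))"
  have N: "l \<in> T (r, c)" "l \<noteq> Min (T (r, c))" "(r, c) \<in> cells n lam" "1 \<le> r" "r < l" "l \<le> n"
    if "((r, c), l) \<in> N" for r c l
    using that nonminimal_letter[OF T lam, of r c l] by (auto simp: N_def)
  have column: "c \<le> c'" if "((r, c), l) \<in> N" "((r, c'), l) \<in> N" for r c c' l
  proof (rule ccontr)
    assume "\<not> c \<le> c'"
    have "Min (T (r, c)) \<in> T (r, c)" using SVT_entry[OF T N(3)[OF that(1)]] by simp
    then have "l \<le> Min (T (r, c))"
      using SVT_row[OF T N(3)[OF that(2)] N(1)[OF that(2)] _ N(3)[OF that(1)]] \<open>\<not> c \<le> c'\<close> by simp
    moreover have "Min (T (r, c)) \<le> l"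
      using Min_le[OF SVT_entry(2)[OF T N(3)[OF that(1)]] N(1)[OF that(1)]] .
    ultimately show False using N(2)[OF that(1)] by simp
  qed
  have "inj_on g N"
  proof (rule inj_onI)
    fix p q assume pq: "p \<in> N" "q \<in> N" "g p = g q"
    obtain r c l r' c' l' where p: "p = ((r, c), l)" and q: "q = ((r', c'), l')"
      by (metis surj_pair)
    have "l = l'" "r = r'"
      using pq N[of r c l] N[of r' c' l'] unfolding p q by (auto simp: g_def)
    moreover from this have "c = c'"
      using column[of r c l c'] column[of r c' l c] pq unfolding p q by auto
    ultimately show "p = q" using p q by simp
  qed
  moreover have "g ` N = U_set n lam T"
  proof
    show "g ` N \<subseteq> U_set n lam T"
    proof
      fix z assume "z \<in> g ` N"
      then obtain r c l where p: "((r, c), l) \<in> N" and z: "z = (n - (l - 1), l - r)"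
        by (auto simp: g_def)
      define k where "k = l - 1"
      have k: "l = k + 1" using N(5)[OF p] by (simp add: k_def)
      show "z \<in> U_set n lam T"
        unfolding U_set_def using N[OF p] z unfolding k
        by (intro CollectI exI[of _ k] exI[of _ r]) auto
    qed
    show "U_set n lam T \<subseteq> g ` N"
    proof
      fix z assume "z \<in> U_set n lam T"
      then obtain k r c where z: "z = (n - k, k + 1 - r)" and c: "(r, c) \<in> cells n lam"
        "k + 1 \<in> T (r, c)" "k + 1 \<noteq> Min (T (r, c))"
        unfolding U_set_def by blast
      then have "((r, c), k + 1) \<in> N" and "z = g ((r, c), k + 1)" by (auto simp: N_def g_def)
      then show "z \<in> g ` N" by blast
    qed
  qed
  ultimately have "card (U_set n lam T) = card N" using card_image by metis
  also have "\<dots> = (\<Sum>x\<in>cells n lam. card (T x - {Min (T x)}))"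
    unfolding N_def by (rule card_SigmaI[OF finite_cells]) (auto dest: SVT_entry(2)[OF T])
  also have "\<dots> = ex n lam T"
    unfolding ex_def
  proof (rule sum.cong[OF refl])
    fix x assume "x \<in> cells n lam"
    then show "card (T x - {Min (T x)}) = card (T x) - 1"
      using SVT_entry[OF T] by (intro card_Diff_singleton Min_in) auto
  qed
  finally show ?thesis .
qed

lemma aff_dim_gz_cell:
  fixes idx :: "nat \<times> nat \<Rightarrow> 'm::finite"
  assumes T: "T \<in> SVT n lam" and lam: "is_partition n lam"
    and idx: "bij_betw idx (coord_positions n) UNIV"
  shows "aff_dim (gz_cell n lam idx T) = int (ex n lam T)"
proof -
  let ?a = "pattern n lam T" and ?U = "U_set n lam T"
  interpret enhanced_pattern n ?a ?U by (rule enhanced_pattern_SVT[OF T lam])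
  interpret gz_geometry n ?a ?U lam idx
    using nu_all[OF T] by unfold_locales (auto simp: idx pattern_def)
  have up_edges: "up_edges n lam T i j = up i j" for i j
    by (simp add: up_edges_def up_def edges_upto_def encircled_def Let_def)
  define bounds where "bounds y i j \<longleftrightarrow>
     (if ?a i j - ?a (i - 1) j \<ge> 2 then ?a i j - 1 < Y y i j else Y y (i - 1) j < Y y i j) \<and>
     (if ?a (i - 1) (j + 1) = ?a i j then Y y i j < Y y (i - 1) (j + 1) else Y y i j < ?a i j)"
    for y i j
  define conditions where "conditions y i j \<longleftrightarrow> (\<forall>(k, l) \<in> up i j. Y y i j = Y y k l) \<and>
     (up i j = {} \<and> (i, j) \<in> encircled n lam T \<longrightarrow> Y y i j = ?a i j) \<and>
     (up i j = {} \<and> (i, j) \<notin> encircled n lam T \<longrightarrow> bounds y i j)" for y i j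
  have conditions: "conditions y (Suc i) j \<longleftrightarrow>
      (\<forall>k l. (k, l) \<in> up (Suc i) j \<longrightarrow> Y y (Suc i) j = Y y k l) \<and>
      (up (Suc i) j = {} \<and> (Suc i, j) \<notin> ?U \<longrightarrow> Y y (Suc i) j = ?a (Suc i) j) \<and>
      ((Suc i, j) \<in> ?U \<longrightarrow> bounds y (Suc i) j)"
    if "(Suc i, j) \<in> coord_positions n" for y i j
    using coord_neighbours(1)[OF that] up_free[of "Suc i" j]
    by (auto simp: conditions_def encircled_def)
  have real_gap: "2 \<le> real_of_int x - real_of_int z \<longleftrightarrow> 2 \<le> x - z" for x z
    by linarith
  have "cell_hat n lam idx T = {y. \<forall>(i, j) \<in> coord_positions n. conditions y i j}"
    by (simp only: cell_hat_def Let_def up_edges conditions_def bounds_def real_gap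
        of_int_eq_iff of_int_diff of_int_1)
  also have "\<dots> = {y. \<forall>i j. (Suc i, j) \<in> coord_positions n \<longrightarrow> conditions y (Suc i) j}"
    using coord_positions_Suc by fastforce
  also have "\<dots> = equations \<inter> {y. \<forall>i j. (Suc i, j) \<in> ?U \<longrightarrow> bounds y (Suc i) j}"
    unfolding equations_def using U_coord conditions by blast
  also have "{y. \<forall>i j. (Suc i, j) \<in> ?U \<longrightarrow> bounds y (Suc i) j} = free_bounds"
    unfolding free_bounds_def bounds_def[symmetric] using coord_positions_Suc U_coord by fastforce
  finally have "cell_hat n lam idx T = equations \<inter> free_bounds" .
  then show ?thesis
    using aff_dim_cell card_U_set[OF T lam] by (simp add: gz_cell_def Let_def)
qed

section \<open>Dimensions along a double string\<close>

theorem theorem6p1p1: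
  fixes n i m :: nat and lam :: "nat \<Rightarrow> nat" and T :: "nat \<Rightarrow> filling"
    and idx :: "nat \<times> nat \<Rightarrow> 'm::finite"
  assumes "n \<ge> 1"
    and "is_partition n lam"
    and "i \<in> {1..n - 1}"
    and "bij_betw idx (coord_positions n) (UNIV :: 'm set)"
    and "double_string n lam i T m"
  shows "odd (m + 1) \<and>
    (\<forall>j. 2 * j + 2 \<le> m \<longrightarrow>
       aff_dim (gz_cell n lam idx (T (2 * j + 1))) = aff_dim (gz_cell n lam idx (T (2 * j))) + 1 \<and>
       aff_dim (gz_cell n lam idx (T (2 * j))) + 1 = aff_dim (gz_cell n lam idx (T (2 * j + 2))) + 1) \<and>
    (\<forall>j \<le> m. aff_dim (gz_cell n lam idx (T j)) = int (ex n lam (T 0)) + int (j mod 2))"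
proof -
  have dim: "aff_dim (gz_cell n lam idx (T j)) = int (ex n lam (T 0)) + int (j mod 2)" if "j \<le> m" for j
  proof -
    have "T j \<in> SVT n lam" using assms(5) that by (simp add: double_string_def)
    then have "aff_dim (gz_cell n lam idx (T j)) = int (ex n lam (T j))"
      using assms(2,4) by (rule aff_dim_gz_cell)
    also have "ex n lam (T j) = ex n lam (T 0) + j mod 2"
      using double_string_excess(2)[OF assms(5)] that by blast
    finally show ?thesis by (simp only: of_nat_add)
  qed
  show ?thesis
    using double_string_excess(1)[OF assms(5)] dim by simp
qed

end
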